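(* Let $C$ be a smooth complete algebraic curve over $\mathbb{C}$ with function field $K$. Let $p\in C$, let $x\in K$ be a local parameter at $p$, and let $f\in K$ be a rational function such that $f\notin\mathbb{C}[x]$ and $v_p(f)=0$. In the completion of the local ring at $p$ write (uniquely) \[ f=\sum_{n=0}^\infty \alpha_n x^{a_n}, \] where $\alpha_n\in\mathbb{C}$, $\alpha_n\neq 0$ for all $n$, and $\{a_n\}_{n\ge 0}$ is a strictly increasing sequence of integers with $a_0=0$. Then for all positive integers $n$ \[ a_n \leq h(f)+(n-1)\left(\#S_1+\sum_{q\in S_2}\left(v_q\left(\frac{dx}{dx_q}\right)+1\right)\right), \] where \[ S_1=\{q\in C : v_q(f)<0 \text{ and } v_q(dx/dx_q)=0\},\qquad S_2=\{q\in C : v_q(x)=0 \text{ and } v_q(dx/dx_q)>0\}, \] and, for each $q \in C$, $x_q$ is a local parameter at $q$.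
   Context: $C$ is a smooth complete algebraic curve (irreducible, as usual) over $\mathbb{C}$ and $K$ is its function field. For each (closed) point $q\in C$, $v_q:K^\times\to\mathbb{Z}$ is the unique surjective discrete valuation at $q$ (order of vanishing at $q$), with $v_q(0)=+\infty$. A local parameter at $q$ is an element $x_q\in K$ with $v_q(x_q)=1$. For $f\in K^\times$ the height is $h(f)=-\sum_{q\in C}\min\{v_q(f),0\}$. For nonconstant $y\in K$, $d/dy$ denotes the unique $\mathbb{C}$-linear derivation of $K$ with $dy/dy=1$; thus $dx/dx_q\in K$ is the ratio of the differentials $dx$ and $dx_q$, and $v_q(dx/dx_q)$ does not depend on the choice of local parameter $x_q$ at $q$. *)

theory Defs
  imports Complex_Main "HOL-Computational_Algebra.Polynomial"
begin

text \<open>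
  Curves are given in the classical language of Chevalley, Zariski and Nagata. A variety over the
  complex numbers with function field \<open>K\<close> is recorded by the local rings of its closed
  points, which are subrings of \<open>K\<close>; a closed point is identified with its local ring.
  The field \<open>K\<close> is the type \<^typ>\<open>'k\<close>, and \<open>\<iota>\<close> is the
  inclusion of the complex numbers in \<open>K\<close>.
\<close>

definition field_embedding :: "(complex \<Rightarrow> 'k::field) \<Rightarrow> bool" where
  "field_embedding \<iota> \<longleftrightarrow> \<iota> 1 = 1 \<and>
     (\<forall>a b. \<iota> (a + b) = \<iota> a + \<iota> b) \<and> (\<forall>a b. \<iota> (a * b) = \<iota> a * \<iota> b)"

definition polys_in :: "(complex \<Rightarrow> 'k::field) \<Rightarrow> 'k \<Rightarrow> 'k set" where
  "polys_in \<iota> x = {poly (map_poly \<iota> P) x | P. True}"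

definition ratfuns_in :: "(complex \<Rightarrow> 'k::field) \<Rightarrow> 'k \<Rightarrow> 'k set" where
  "ratfuns_in \<iota> x = {a / b | a b. a \<in> polys_in \<iota> x \<and> b \<in> polys_in \<iota> x \<and> b \<noteq> 0}"

definition algebraic_over :: "'k::field set \<Rightarrow> 'k \<Rightarrow> bool" where
  "algebraic_over F y \<longleftrightarrow> (\<exists>P. P \<noteq> 0 \<and> set (coeffs P) \<subseteq> F \<and> poly P y = 0)"

definition trdeg_one :: "(complex \<Rightarrow> 'k::field) \<Rightarrow> bool" where
  "trdeg_one \<iota> \<longleftrightarrow>
     (\<exists>x. \<not> algebraic_over (range \<iota>) x \<and> (\<forall>y. algebraic_over (ratfuns_in \<iota> x) y))"

definition subalgebra :: "(complex \<Rightarrow> 'k::field) \<Rightarrow> 'k set \<Rightarrow> bool" where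
  "subalgebra \<iota> A \<longleftrightarrow> range \<iota> \<subseteq> A \<and> (\<forall>a\<in>A. \<forall>b\<in>A. a + b \<in> A \<and> a * b \<in> A)"

definition finitely_generated :: "(complex \<Rightarrow> 'k::field) \<Rightarrow> 'k set \<Rightarrow> bool" where
  "finitely_generated \<iota> A \<longleftrightarrow>
     (\<exists>S. finite S \<and> A = \<Inter>{B. subalgebra \<iota> B \<and> S \<subseteq> B})"

definition has_fraction_field_UNIV :: "'k::field set \<Rightarrow> bool" where
  "has_fraction_field_UNIV A \<longleftrightarrow> (\<forall>g. \<exists>a\<in>A. \<exists>b\<in>A. b \<noteq> 0 \<and> g = a / b)"

definition is_ideal :: "'k::field set \<Rightarrow> 'k set \<Rightarrow> bool" where
  "is_ideal A I \<longleftrightarrow> I \<subseteq> A \<and> 0 \<in> I \<and> (\<forall>a\<in>I. \<forall>b\<in>I. a + b \<in> I) \<and>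
     (\<forall>a\<in>A. \<forall>b\<in>I. a * b \<in> I)"

definition is_maximal_ideal :: "'k::field set \<Rightarrow> 'k set \<Rightarrow> bool" where
  "is_maximal_ideal A M \<longleftrightarrow> is_ideal A M \<and> M \<noteq> A \<and>
     (\<forall>J. is_ideal A J \<longrightarrow> M \<subseteq> J \<longrightarrow> J = M \<or> J = A)"

definition localization :: "'k::field set \<Rightarrow> 'k set \<Rightarrow> 'k set" where
  "localization A M = {a / b | a b. a \<in> A \<and> b \<in> A - M}"

definition affine_model :: "(complex \<Rightarrow> 'k::field) \<Rightarrow> 'k set \<Rightarrow> bool" where
  "affine_model \<iota> A \<longleftrightarrow> subalgebra \<iota> A \<and> finitely_generated \<iota> A \<and> has_fraction_field_UNIV A"

definition affine_points :: "'k::field set \<Rightarrow> 'k set set" where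
  "affine_points A = {localization A M | M. is_maximal_ideal A M}"

definition nonunits :: "'k::field set \<Rightarrow> 'k set" where
  "nonunits R = {g \<in> R. g = 0 \<or> inverse g \<notin> R}"

definition valuation_ring :: "(complex \<Rightarrow> 'k::field) \<Rightarrow> 'k set \<Rightarrow> bool" where
  "valuation_ring \<iota> V \<longleftrightarrow> subalgebra \<iota> V \<and> (\<forall>g. g \<in> V \<or> inverse g \<in> V)"

definition dominates :: "'k::field set \<Rightarrow> 'k set \<Rightarrow> bool" where
  "dominates V R \<longleftrightarrow> R \<subseteq> V \<and> nonunits V \<inter> R = nonunits R"

text \<open>
  A regular local ring of dimension one: the maximal ideal is nonzero and generated by one element.
\<close>

definition regular_dim_one :: "'k::field set \<Rightarrow> bool" where
  "regular_dim_one R \<longleftrightarrow> (\<exists>t. t \<noteq> 0 \<and> nonunits R = {t * a | a. a \<in> R})"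

text \<open>
  The fourth condition is the valuative criterion: \<open>C\<close> is separated (at most one
  \<open>q\<close>) and complete (at least one). The trivial valuation ring \<open>K\<close> is
  excluded because it dominates the local ring of the generic point, which is not a closed point.
\<close>

definition smooth_complete_curve :: "(complex \<Rightarrow> 'k::field) \<Rightarrow> 'k set set \<Rightarrow> bool" where
  "smooth_complete_curve \<iota> C \<longleftrightarrow>
     field_embedding \<iota> \<and>
     trdeg_one \<iota> \<and>
     (\<exists>\<A>. finite \<A> \<and> (\<forall>A\<in>\<A>. affine_model \<iota> A) \<and> C = (\<Union>A\<in>\<A>. affine_points A)) \<and>
     (\<forall>V. valuation_ring \<iota> V \<longrightarrow> V \<noteq> UNIV \<longrightarrow> (\<exists>!q. q \<in> C \<and> dominates V q)) \<and>
     (\<forall>q\<in>C. regular_dim_one q)"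

text \<open>
  Valuations are integer-valued, so the value at \<open>0\<close>, which ought to be \<open>+\<infinity>\<close>, is set to the
  junk value \<open>0\<close>. Wherever it matters, \<open>0\<close> is treated separately.
\<close>

definition discrete_valuation :: "('k::field \<Rightarrow> int) \<Rightarrow> bool" where
  "discrete_valuation v \<longleftrightarrow> v 0 = 0 \<and> v ` (- {0}) = UNIV \<and>
     (\<forall>a b. a \<noteq> 0 \<longrightarrow> b \<noteq> 0 \<longrightarrow> v (a * b) = v a + v b) \<and>
     (\<forall>a b. a \<noteq> 0 \<longrightarrow> b \<noteq> 0 \<longrightarrow> a + b \<noteq> 0 \<longrightarrow> min (v a) (v b) \<le> v (a + b))"

text \<open>The valuation \<open>v\<^sub>q\<close>; it is unique by the lemma below.\<close>

definition val_at :: "'k::field set \<Rightarrow> 'k \<Rightarrow> int" where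
  "val_at q = (THE v. discrete_valuation v \<and> q = {g. g = 0 \<or> 0 \<le> v g})"

lemma discrete_valuation_unique:
  fixes v w :: "'k::field \<Rightarrow> int"
  assumes v: "discrete_valuation v" and w: "discrete_valuation w"
    and eq: "{g. g = 0 \<or> 0 \<le> v g} = {g. g = 0 \<or> 0 \<le> w g}"
  shows "v = w"
proof
  have mv: "v (a * b) = v a + v b" and mw: "w (a * b) = w a + w b" if "a \<noteq> 0" "b \<noteq> 0" for a b
    using that v w unfolding discrete_valuation_def by blast+
  have one: "v 1 = 0" "w 1 = 0" using mv[of 1 1] mw[of 1 1] by auto
  have iv: "v (inverse a) = - v a" and iw: "w (inverse a) = - w a" if "a \<noteq> 0" for a
    using mv[of a "inverse a"] mw[of a "inverse a"] that one by auto
  have nn: "0 \<le> v g \<longleftrightarrow> 0 \<le> w g" if "g \<noteq> 0" for g using eq that by blast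
  have zero: "w g = 0" if "g \<noteq> 0" "v g = 0" for g
    using nn[of g] nn[of "inverse g"] iv iw that by auto
  have pv: "v (a ^ n) = int n * v a" and pw: "w (a ^ n) = int n * w a" if "a \<noteq> 0" for a n
    using that one mv mw by (induction n) (auto simp: algebra_simps)
  obtain t where t: "t \<noteq> 0" "v t = 1"
    using v unfolding discrete_valuation_def by (metis ComplD UNIV_I imageE insertI1)
  have mult: "w g = v g * w t" if g: "g \<noteq> 0" for g
  proof (cases "0 \<le> v g")
    case True
    have "v (g * inverse (t ^ nat (v g))) = 0" using g t True by (simp add: mv iv pv)
    then have "w (g * inverse (t ^ nat (v g))) = 0" using g t by (intro zero) auto
    then show ?thesis using g t True by (simp add: mw iw pw)
  next
    case False
    have "v (g * t ^ nat (- v g)) = 0" using g t False by (simp add: mv pv)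
    then have "w (g * t ^ nat (- v g)) = 0" using g t by (intro zero) auto
    then show ?thesis using g t False by (simp add: mw pw)
  qed
  obtain s where s: "s \<noteq> 0" "w s = 1"
    using w unfolding discrete_valuation_def by (metis ComplD UNIV_I imageE insertI1)
  have "w t dvd 1" using mult[of s] s by (metis dvd_triv_right)
  moreover have "0 \<le> w t" using nn[of t] t by simp
  ultimately have "w t = 1" by (simp add: zdvd1_eq)
  then show "v g = w g" for g
    using mult[of g] v w by (cases "g = 0") (auto simp: discrete_valuation_def)
qed

definition local_parameter :: "'k::field set \<Rightarrow> 'k \<Rightarrow> bool" where
  "local_parameter q t \<longleftrightarrow> t \<noteq> 0 \<and> val_at q t = 1"

text \<open>
  The sum is restricted to the (finitely many) poles, where its terms are nonzero, because a sum
  over the infinite set \<open>C\<close> would be \<open>0\<close> by convention.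
\<close>

definition height :: "'k::field set set \<Rightarrow> 'k \<Rightarrow> int" where
  "height C f = - (\<Sum>q\<in>{q\<in>C. val_at q f < 0}. min (val_at q f) 0)"

definition linear_derivation :: "(complex \<Rightarrow> 'k::field) \<Rightarrow> ('k \<Rightarrow> 'k) \<Rightarrow> bool" where
  "linear_derivation \<iota> D \<longleftrightarrow>
     (\<forall>a b. D (a + b) = D a + D b) \<and> (\<forall>c a. D (\<iota> c * a) = \<iota> c * D a) \<and>
     (\<forall>a b. D (a * b) = a * D b + b * D a)"

text \<open>\<open>deriv_wrt \<iota> y g\<close> is \<open>dg/dy\<close>, for nonconstant \<open>y\<close>.\<close>

definition deriv_wrt :: "(complex \<Rightarrow> 'k::field) \<Rightarrow> 'k \<Rightarrow> 'k \<Rightarrow> 'k" where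
  "deriv_wrt \<iota> y = (THE D. linear_derivation \<iota> D \<and> D y = 1)"

text \<open>
  The series with terms \<open>s n\<close> has sum \<open>g\<close> in the completion of the local ring at \<open>q\<close>: the partial
  sums converge to \<open>g\<close> in the adic topology, whose basic neighbourhoods of \<open>0\<close> are the powers
  of the maximal ideal.
\<close>

definition sums_at :: "'k::field set \<Rightarrow> (nat \<Rightarrow> 'k) \<Rightarrow> 'k \<Rightarrow> bool" where
  "sums_at q s g \<longleftrightarrow>
     (\<forall>M. \<forall>\<^sub>F N in sequentially. g - (\<Sum>n<N. s n) = 0 \<or> M \<le> val_at q (g - (\<Sum>n<N. s n)))"

end

theory Submission
  imports
    Defs
    "HOL-Computational_Algebra.Formal_Laurent_Series"
    "HOL-Computational_Algebra.Fundamental_Theorem_Algebra"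
begin

unbundle fps_syntax

text \<open>
  Why the bound holds. Let \<open>\<theta> g = x dg/dx\<close>. On expansions in powers of \<open>x\<close> at \<open>p\<close> it multiplies
  the coefficient of \<open>x ^ m\<close> by \<open>m\<close>, so \<open>\<theta> - a\<^sub>1, \<dots>, \<theta> - a\<^sub>n\<^sub>-\<^sub>1\<close> applied one after the
  other to \<open>f - \<alpha>\<^sub>0\<close> give a function \<open>F\<close> whose first nonzero term is a multiple of \<open>x\<close> to the
  power \<open>a\<^sub>n\<close>. A function has no more zeros than poles, so \<open>a\<^sub>n\<close> is at most the number of
  poles of \<open>F\<close> with multiplicity. The poles of \<open>f - \<alpha>\<^sub>0\<close> contribute \<open>h(f)\<close>, and each of the
  \<open>n - 1\<close> applications of \<open>\<theta>\<close> adds little (\<open>euler_pole_bound\<close>): at a zero or a pole of \<open>x\<close> the factor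
  \<open>x\<close> makes up for the order lost to differentiation; where \<open>x\<close> minus a constant is a local
  parameter \<open>\<theta>\<close> raises the order of an existing pole by one and creates none (the set \<open>S1\<close>);
  and where \<open>dx\<close> vanishes to order \<open>e > 0\<close> it costs at most \<open>e + 1\<close> (the set \<open>S2\<close>).

  Everything about points rests on \<open>polynomial_multiple\<close>: for \<open>y\<close> and \<open>g \<noteq> 0\<close> in \<open>K\<close> some
  polynomial \<open>P \<noteq> 0\<close> over the complex numbers has \<open>P(y)\<close> divisible by \<open>g\<close> in every subalgebra
  that contains \<open>y\<close> and \<open>g\<close>. It comes from the algebraic dependence of any two elements of \<open>K\<close>,
  which a dimension count gives. At a point it forces the residue field to be the complex
  numbers and a function with zero expansion to vanish. So a local parameter \<open>t\<close> embeds \<open>K\<close> in the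
  Laurent series in \<open>t\<close>, with \<open>v\<^sub>q\<close> becoming the order of a series. On an affine model it
  leaves only finitely many possible residues for each algebra generator at the poles of a function,
  whence finiteness of the poles.

  The derivation \<open>d/dt\<close> is the termwise derivative of Laurent series: it maps the image of \<open>K\<close> to
  itself because differentiating an algebraic relation between \<open>g\<close> and \<open>t\<close> expresses \<open>dg/dt\<close> through \<open>g\<close>
  and \<open>t\<close>.

  The comparison of zeros and poles (\<open>order_le_poles\<close>) is linear algebra. If \<open>g\<close> vanishes at
  \<open>p\<close> to an order \<open>n\<close> that exceeds the number of its poles, then the products
  \<open>g ^ i * x ^ j\<close> with \<open>j < n\<close> and \<open>i \<le> k\<close> are, for large \<open>k\<close>, more numerous than the
  coefficients of their principal parts. Some combination of those other than \<open>1\<close> then has no pole,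
  yet is not constant, as the orders at \<open>p\<close> are all different and positive. On a complete curve this is
  impossible (\<open>nonconstant_has_pole\<close>): a subalgebra that is maximal with \<open>g\<close> outside and \<open>1/g\<close>
  inside is a valuation ring, and the valuative criterion turns it into a pole of \<open>g\<close>.
\<close>

section \<open>Homogeneous linear systems\<close>

lemma underdetermined_system:
  fixes A :: "'i \<Rightarrow> 'j \<Rightarrow> 'a::field"
  assumes "finite J" "finite I" "card J < card I"
  shows "\<exists>l. (\<exists>i\<in>I. l i \<noteq> 0) \<and> (\<forall>j\<in>J. (\<Sum>i\<in>I. l i * A i j) = 0)"
  using assms
proof (induction J arbitrary: I A rule: finite_induct)
  case empty
  then have "I \<noteq> {}" by (intro notI) simp
  then show ?case by (intro exI[of _ "\<lambda>_. 1"]) auto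
next
  case (insert j J)
  show ?case
  proof (cases "\<forall>i\<in>I. A i j = 0")
    case True
    have "card J < card I" using insert by simp
    then obtain l where "\<exists>i\<in>I. l i \<noteq> 0" "\<forall>j\<in>J. (\<Sum>i\<in>I. l i * A i j) = 0"
      using insert.IH[of I A] insert.prems by blast
    with True show ?thesis by (intro exI[of _ l]) auto
  next
    case False
    then obtain k where k: "k \<in> I" "A k j \<noteq> 0" by blast
    define A' where "A' = (\<lambda>i j'. A i j' - A i j / A k j * A k j')"
    have "card J < card (I - {k})" using insert k by simp
    then obtain l where l: "\<exists>i\<in>I - {k}. l i \<noteq> 0"
        "\<forall>j\<in>J. (\<Sum>i\<in>I - {k}. l i * A' i j) = 0"
      using insert.IH[of "I - {k}" A'] insert.prems by blast
    define l' where "l' = l(k := - (\<Sum>i\<in>I - {k}. l i * (A i j / A k j)))"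
    have split: "(\<Sum>i\<in>I. l' i * A i j') = (\<Sum>i\<in>I - {k}. l i * A' i j')" for j'
    proof -
      have "(\<Sum>i\<in>I. l' i * A i j') = l' k * A k j' + (\<Sum>i\<in>I - {k}. l' i * A i j')"
        using k insert.prems by (simp add: sum.remove)
      also have "(\<Sum>i\<in>I - {k}. l' i * A i j') = (\<Sum>i\<in>I - {k}. l i * A i j')"
        by (intro sum.cong) (auto simp: l'_def)
      finally show ?thesis
        by (simp add: l'_def A'_def sum_distrib_right sum_subtractf right_diff_distrib mult.assoc)
    qed
    have "A' i j = 0" for i using k by (simp add: A'_def)
    then have "(\<Sum>i\<in>I. l' i * A i j') = 0" if "j' \<in> insert j J" for j'
      using that l split by auto
    moreover have "\<exists>i\<in>I. l' i \<noteq> 0" using l by (auto simp: l'_def)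
    ultimately show ?thesis by blast
  qed
qed

section \<open>Evaluating polynomials in an extension of the complex numbers\<close>

locale complex_field_extension =
  fixes \<iota> :: "complex \<Rightarrow> 'k::field"
  assumes emb: "field_embedding \<iota>"
begin

lemma iota_1 [simp]: "\<iota> 1 = 1"
  and iota_add: "\<iota> (a + b) = \<iota> a + \<iota> b"
  and iota_mult: "\<iota> (a * b) = \<iota> a * \<iota> b"
  using emb unfolding field_embedding_def by blast+

lemma iota_0 [simp]: "\<iota> 0 = 0"
  by (metis add_0 add_cancel_left_left iota_add)

lemma iota_minus: "\<iota> (- a) = - \<iota> a"
  using iota_add[of a "- a"] by (simp add: eq_neg_iff_add_eq_0 add.commute)

lemma iota_diff: "\<iota> (a - b) = \<iota> a - \<iota> b"
  using iota_add[of a "- b"] by (simp add: iota_minus)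

lemma iota_eq_0_iff [simp]: "\<iota> a = 0 \<longleftrightarrow> a = 0"
proof
  assume "\<iota> a = 0"
  then show "a = 0" using iota_mult[of a "inverse a"] by (cases "a = 0") auto
qed simp

lemma iota_inverse: "\<iota> (inverse a) = inverse (\<iota> a)"
proof (cases "a = 0")
  case False
  then have "\<iota> a * \<iota> (inverse a) = 1" by (simp flip: iota_mult)
  then show ?thesis by (metis inverse_unique)
qed simp

lemma iota_sum: "\<iota> (sum g S) = (\<Sum>i\<in>S. \<iota> (g i))"
  by (induction S rule: infinite_finite_induct) (auto simp: iota_add)

definition ev :: "complex poly \<Rightarrow> 'k \<Rightarrow> 'k" where
  "ev P y = poly (map_poly \<iota> P) y"

text \<open>
  The outer variable of \<open>F\<close> is specialised to \<open>z\<close>, the variable of the coefficients to \<open>y\<close>.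
\<close>

definition ev2 :: "complex poly poly \<Rightarrow> 'k \<Rightarrow> 'k \<Rightarrow> 'k" where
  "ev2 F y z = poly (map_poly (\<lambda>P. ev P y) F) z"

lemma ev_0 [simp]: "ev 0 y = 0" by (simp add: ev_def)

lemma ev_pCons [simp]: "ev (pCons a P) y = \<iota> a + y * ev P y"
  by (simp add: ev_def map_poly_pCons)

lemma ev_add: "ev (P + Q) y = ev P y + ev Q y"
  by (induction P Q rule: poly_induct2) (auto simp: iota_add algebra_simps)

lemma ev_smult: "ev (smult c P) y = \<iota> c * ev P y"
  by (induction P) (auto simp: iota_mult algebra_simps)

lemma ev_diff: "ev (P - Q) y = ev P y - ev Q y"
  using ev_add[of P "- Q" y] ev_smult[of "- 1" Q y] by (simp add: iota_minus)

lemma ev_mult: "ev (P * Q) y = ev P y * ev Q y"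
  by (induction P) (auto simp: ev_add ev_smult algebra_simps)

lemma ev_1 [simp]: "ev 1 y = 1" by (simp add: one_pCons)

lemma ev_sum: "ev (sum g S) y = (\<Sum>i\<in>S. ev (g i) y)"
  by (induction S rule: infinite_finite_induct) (auto simp: ev_add)

lemma ev_prod: "ev (prod g S) y = (\<Prod>i\<in>S. ev (g i) y)"
  by (induction S rule: infinite_finite_induct) (auto simp: ev_mult)

lemma ev_monom [simp]: "ev (monom c n) y = \<iota> c * y ^ n"
  by (induction n) (auto simp: monom_0 monom_Suc algebra_simps)

lemma ev_altdef: "degree P \<le> n \<Longrightarrow> ev P y = (\<Sum>i\<le>n. \<iota> (coeff P i) * y ^ i)"
  by (subst poly_as_sum_of_monoms'[of P n, symmetric]) (simp_all add: ev_sum)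

lemma ev2_0 [simp]: "ev2 0 y z = 0" by (simp add: ev2_def)

lemma ev2_pCons [simp]: "ev2 (pCons P F) y z = ev P y + z * ev2 F y z"
  by (simp add: ev2_def map_poly_pCons)

lemma ev2_add: "ev2 (F + G) y z = ev2 F y z + ev2 G y z"
  by (induction F G rule: poly_induct2) (auto simp: ev_add algebra_simps)

lemma ev2_monom [simp]: "ev2 (monom P n) y z = ev P y * z ^ n"
  by (induction n) (auto simp: monom_0 monom_Suc algebra_simps)

lemma ev2_sum: "ev2 (sum g S) y z = (\<Sum>i\<in>S. ev2 (g i) y z)"
  by (induction S rule: infinite_finite_induct) (auto simp: ev2_add)

text \<open>
  The complex numbers are algebraically closed, so every value of a nonzero polynomial is a product
  of a nonzero constant and factors \<open>y - r\<close>. With the nonzero elements as \<open>U\<close> this says that nonconstant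
  elements are transcendental; with the units of a local ring it will give the residue field.
\<close>

lemma ev_split_mem:
  assumes "P \<noteq> 0"
    and "\<And>c. c \<noteq> 0 \<Longrightarrow> \<iota> c \<in> U" and "\<And>r. y - \<iota> r \<in> U" and "\<And>a b. a \<in> U \<Longrightarrow> b \<in> U \<Longrightarrow> a * b \<in> U"
  shows "ev P y \<in> U"
  using assms(1)
proof (induction "degree P" arbitrary: P)
  case 0
  then obtain c where "P = [:c:]" by (metis degree_eq_zeroE)
  then show ?case using 0 assms by auto
next
  case (Suc n)
  then have "\<not> constant (poly P)" by (simp add: constant_degree)
  then obtain r where "poly P r = 0" using fundamental_theorem_of_algebra by blast
  then obtain Q where Q: "P = [:- r, 1:] * Q" by (metis poly_eq_0_iff_dvd dvdE)
  with Suc have "Q \<noteq> 0" "degree Q = n" by (auto simp: degree_mult_eq simp del: mult_pCons_left)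
  with Suc have "ev Q y \<in> U" by auto
  moreover have "ev P y = (y - \<iota> r) * ev Q y" unfolding Q ev_mult by (simp add: iota_minus)
  ultimately show ?case using assms by auto
qed

lemma nonconstant_ev_nonzero:
  assumes "y \<notin> range \<iota>" "P \<noteq> 0"
  shows "ev P y \<noteq> 0"
  using ev_split_mem[of P "- {0}" y] assms by auto

text \<open>
  The map \<open>\<delta>\<close> is a derivation with values in a second field, along an embedding \<open>\<phi>\<close>. This covers both
  the difference of two derivations of \<open>K\<close> and the derivative of an expansion.
\<close>

lemma derivation_ev:
  fixes \<phi> \<delta> :: "'k \<Rightarrow> 'l::field"
  assumes "\<And>a b. \<phi> (a + b) = \<phi> a + \<phi> b" and "\<And>a b. \<phi> (a * b) = \<phi> a * \<phi> b"
    and "\<And>a b. \<delta> (a + b) = \<delta> a + \<delta> b" and "\<And>c. \<delta> (\<iota> c) = 0"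
    and "\<And>a b. \<delta> (a * b) = \<phi> a * \<delta> b + \<phi> b * \<delta> a"
  shows "\<delta> (ev P y) = \<phi> (ev (pderiv P) y) * \<delta> y"
proof (induction P)
  case 0
  have "\<phi> 0 = 0" by (metis add_0 add_cancel_left_left assms(1))
  then show ?case using assms(4)[of 0] by simp
next
  case (pCons a P)
  then show ?case by (simp add: assms(3-5) pderiv_pCons ev_add) (simp add: assms algebra_simps)
qed

lemma derivation_ev2:
  fixes \<phi> \<delta> :: "'k \<Rightarrow> 'l::field"
  assumes \<phi>: "\<And>a b. \<phi> (a + b) = \<phi> a + \<phi> b" "\<And>a b. \<phi> (a * b) = \<phi> a * \<phi> b"
    and \<delta>: "\<And>a b. \<delta> (a + b) = \<delta> a + \<delta> b" "\<And>c. \<delta> (\<iota> c) = 0"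
      "\<And>a b. \<delta> (a * b) = \<phi> a * \<delta> b + \<phi> b * \<delta> a"
  shows "\<delta> (ev2 F y z) = \<phi> (ev2 (map_poly pderiv F) y z) * \<delta> y + \<phi> (ev2 (pderiv F) y z) * \<delta> z"
proof (induction F)
  case 0
  have "\<phi> 0 = 0" by (metis add_0 add_cancel_left_left \<phi>(1))
  then show ?case using \<delta>(2)[of 0] by simp
next
  case (pCons P F)
  note ev = derivation_ev[where \<phi> = \<phi> and \<delta> = \<delta>, OF \<phi> \<delta>, of P y]
  have 0: "\<phi> 0 = 0" by (metis add_0 add_cancel_left_left \<phi>(1))
  show ?case
    by (simp add: pCons.IH ev \<delta> \<phi> 0 pderiv_pCons map_poly_pCons ev2_add) (simp add: algebra_simps)
qed

end

section \<open>Subalgebras and algebraic dependence\<close>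

context complex_field_extension
begin

lemma iota_mem: "subalgebra \<iota> B \<Longrightarrow> \<iota> c \<in> B"
  and subalgebra_add: "subalgebra \<iota> B \<Longrightarrow> a \<in> B \<Longrightarrow> b \<in> B \<Longrightarrow> a + b \<in> B"
  and subalgebra_mult: "subalgebra \<iota> B \<Longrightarrow> a \<in> B \<Longrightarrow> b \<in> B \<Longrightarrow> a * b \<in> B"
  unfolding subalgebra_def by auto

lemma subalgebra_uminus: "subalgebra \<iota> B \<Longrightarrow> a \<in> B \<Longrightarrow> - a \<in> B"
  using subalgebra_mult[of B "\<iota> (- 1)" a] iota_mem[of B "- 1"] by (simp add: iota_minus)

lemma subalgebra_diff: "subalgebra \<iota> B \<Longrightarrow> a \<in> B \<Longrightarrow> b \<in> B \<Longrightarrow> a - b \<in> B"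
  using subalgebra_add[of B a "- b"] subalgebra_uminus by simp

lemma subalgebra_1: "subalgebra \<iota> B \<Longrightarrow> 1 \<in> B"
  and subalgebra_0: "subalgebra \<iota> B \<Longrightarrow> 0 \<in> B"
  using iota_mem[of B 1] iota_mem[of B 0] by auto

lemma subalgebra_power: "subalgebra \<iota> B \<Longrightarrow> a \<in> B \<Longrightarrow> a ^ n \<in> B"
  by (induction n) (auto simp: subalgebra_1 subalgebra_mult)

lemma subalgebra_sum: "subalgebra \<iota> B \<Longrightarrow> (\<And>i. i \<in> I \<Longrightarrow> g i \<in> B) \<Longrightarrow> sum g I \<in> B"
  by (induction I rule: infinite_finite_induct) (auto simp: subalgebra_0 subalgebra_add)

lemma subalgebra_ev: "subalgebra \<iota> B \<Longrightarrow> y \<in> B \<Longrightarrow> ev P y \<in> B"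
  by (induction P) (auto simp: subalgebra_0 iota_mem subalgebra_add subalgebra_mult)

lemma subalgebra_ev2: "subalgebra \<iota> B \<Longrightarrow> y \<in> B \<Longrightarrow> z \<in> B \<Longrightarrow> ev2 F y z \<in> B"
  by (induction F) (auto simp: subalgebra_0 subalgebra_ev subalgebra_add subalgebra_mult)

lemmas subalgebra_closed = iota_mem subalgebra_add subalgebra_mult subalgebra_uminus
  subalgebra_diff subalgebra_1 subalgebra_0 subalgebra_power

lemma algebraic_over_ratfuns_relation:
  assumes "algebraic_over (ratfuns_in \<iota> x) y"
  obtains d cs where "(\<Sum>i\<le>d. ev (cs i) x * y ^ i) = 0" "ev (cs d) x \<noteq> 0" "d > 0"
proof -
  obtain P where P: "P \<noteq> 0" "set (coeffs P) \<subseteq> ratfuns_in \<iota> x" "poly P y = 0"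
    using assms unfolding algebraic_over_def by blast
  have "\<exists>a b. coeff P i = ev a x / ev b x \<and> ev b x \<noteq> 0" for i
  proof (cases "coeff P i = 0")
    case True
    then show ?thesis by (intro exI[of _ 0] exI[of _ 1]) auto
  next
    case False
    then have "coeff P i \<in> set (coeffs P)" by (simp add: coeff_in_coeffs le_degree P)
    with P(2) show ?thesis unfolding ratfuns_in_def polys_in_def ev_def by blast
  qed
  then obtain a b where ab: "\<And>i. coeff P i = ev (a i) x / ev (b i) x" "\<And>i. ev (b i) x \<noteq> 0"
    by metis
  define d where "d = degree P"
  \<comment> \<open>Clearing denominators: all coefficients are multiplied by the product of the \<open>b j\<close>.\<close>
  define cs where "cs = (\<lambda>i. a i * (\<Prod>j\<in>{..d} - {i}. b j))"
  define c where "c = (\<Prod>j\<le>d. ev (b j) x)"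
  have "c \<noteq> 0" using ab by (simp add: c_def)
  have cs: "ev (cs i) x = c * coeff P i" if "i \<le> d" for i
  proof -
    have "c = ev (b i) x * (\<Prod>j\<in>{..d} - {i}. ev (b j) x)"
      unfolding c_def using that by (simp add: prod.remove)
    then show ?thesis using ab by (simp add: cs_def ev_mult ev_prod)
  qed
  have "(\<Sum>i\<le>d. ev (cs i) x * y ^ i) = c * poly P y"
    unfolding poly_altdef sum_distrib_left d_def[symmetric]
    by (intro sum.cong) (auto simp: cs mult.assoc)
  moreover have "ev (cs d) x \<noteq> 0" using cs[of d] \<open>c \<noteq> 0\<close> P by (simp add: d_def)
  moreover have "d > 0"
  proof (rule ccontr)
    assume "\<not> d > 0"
    then obtain a where "P = [:a:]" by (metis d_def degree_eq_zeroE gr0I)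
    with P show False by simp
  qed
  ultimately show ?thesis using that P(3) by simp
qed

text \<open>
  The powers \<open>y ^ n\<close> with \<open>n \<le> N\<close> reduce, after multiplication by one common denominator, to
  combinations of \<open>1, \<dots>, y ^ (d - 1)\<close> whose coefficients have degree linear in \<open>N\<close>. The linear growth
  is what makes the count in \<open>algebraically_dependent\<close> succeed.
\<close>

lemma reduce_power:
  assumes rel: "(\<Sum>i\<le>d. ev (cs i) x * y ^ i) = 0" and "d > 0"
    and deg: "\<And>i. i \<le> d \<Longrightarrow> degree (cs i) \<le> B"
    and "n \<le> N"
  shows "\<exists>p. ev (cs d) x ^ N * y ^ n = (\<Sum>i<d. ev (p i) x * y ^ i) \<and> (\<forall>i<d. degree (p i) \<le> B * N)"
  using \<open>n \<le> N\<close>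
proof (induction N arbitrary: n)
  case 0
  then show ?case using \<open>d > 0\<close>
    by (intro exI[of _ "\<lambda>i. if i = 0 then 1 else 0"], cases d)
      (auto simp: sum.lessThan_Suc_shift simp del: sum.lessThan_Suc)
next
  case (Suc N)
  show ?case
  proof (cases "n \<le> N")
    case True
    then obtain p where p: "ev (cs d) x ^ N * y ^ n = (\<Sum>i<d. ev (p i) x * y ^ i)"
        "\<forall>i<d. degree (p i) \<le> B * N"
      using Suc.IH by blast
    have "degree (cs d * p i) \<le> B * Suc N" if "i < d" for i
      using degree_mult_le[of "cs d" "p i"] deg[of d] p(2)[rule_format, OF that] by simp
    moreover have "ev (cs d) x ^ Suc N * y ^ n = (\<Sum>i<d. ev (cs d * p i) x * y ^ i)"
      by (simp add: ev_mult mult.assoc p(1) flip: sum_distrib_left)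
    ultimately show ?thesis by (intro exI[of _ "\<lambda>i. cs d * p i"]) auto
  next
    case False
    with Suc have n: "n = Suc N" by simp
    obtain p where p: "ev (cs d) x ^ N * y ^ N = (\<Sum>i<d. ev (p i) x * y ^ i)"
        "\<forall>i<d. degree (p i) \<le> B * N"
      using Suc.IH by blast
    obtain e where e: "d = Suc e" using \<open>d > 0\<close> by (cases d) auto
    \<comment> \<open>Multiply the reduction of \<open>y ^ N\<close> by \<open>cs d * y\<close>; the relation replaces the top power
      \<open>cs d * y ^ d\<close> by lower ones.\<close>
    define p' where "p' = (\<lambda>i. (if i = 0 then 0 else cs d * p (i - 1)) - p e * cs i)"
    have "degree (p' i) \<le> B * Suc N" if "i < d" for i
      unfolding p'_def
    proof (intro degree_diff_le)
      have "i - 1 < d" using that by simp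
      then have "degree (cs d * p (i - 1)) \<le> B + B * N"
        using degree_mult_le[of "cs d" "p (i - 1)"] deg[of d] p(2) by (meson add_mono le_refl order_trans)
      then show "degree (if i = 0 then 0 else cs d * p (i - 1)) \<le> B * Suc N" by simp
      show "degree (p e * cs i) \<le> B * Suc N"
        using degree_mult_le[of "p e" "cs i"] deg[of i] p(2)[rule_format, of e] that e by simp
    qed
    moreover have "ev (cs d) x ^ Suc N * y ^ n = (\<Sum>i<d. ev (p' i) x * y ^ i)"
    proof -
      have "ev (cs d) x ^ Suc N * y ^ n = ev (cs d) x * y * (ev (cs d) x ^ N * y ^ N)"
        by (simp add: n)
      also have "\<dots> = (\<Sum>i<e. ev (cs d) x * ev (p i) x * y ^ Suc i) + ev (p e) x * (ev (cs d) x * y ^ d)"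
        unfolding p(1) by (simp add: e distrib_left sum_distrib_left algebra_simps)
      also have "ev (cs d) x * y ^ d = - (\<Sum>i<d. ev (cs i) x * y ^ i)"
        using rel by (simp add: lessThan_Suc_atMost[symmetric] eq_neg_iff_add_eq_0 add.commute)
      also have "(\<Sum>i<e. ev (cs d) x * ev (p i) x * y ^ Suc i)
          = (\<Sum>i<d. (if i = 0 then 0 else ev (cs d * p (i - 1)) x) * y ^ i)"
        unfolding e sum.lessThan_Suc_shift by (simp add: ev_mult)
      finally show ?thesis
        by (simp add: p'_def sum_distrib_left sum_subtractf[symmetric] left_diff_distrib
            ev_mult mult.assoc if_distrib[of "\<lambda>p. ev p x"] ev_diff cong: if_cong)
    qed
    ultimately show ?thesis by (intro exI[of _ p']) auto
  qed
qed

end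

locale complex_function_field = complex_field_extension \<iota>
  for \<iota> :: "complex \<Rightarrow> 'k::field" +
  assumes trdeg: "trdeg_one \<iota>"
begin

text \<open>
  The \<open>(N + 1)\<^sup>2\<close> products \<open>y ^ i * z ^ j\<close> with \<open>i, j \<le> N\<close>, once multiplied by a common denominator, are
  combinations of \<open>x ^ a * y ^ k * z ^ l\<close> with \<open>k < d\<close>, \<open>l < m\<close> and \<open>a\<close> bounded linearly in \<open>N\<close>. For large \<open>N\<close>
  there are fewer of the latter, so the former are linearly dependent over the complex numbers.
\<close>

lemma algebraically_dependent: "\<exists>F. F \<noteq> 0 \<and> ev2 F y z = 0"
proof -
  obtain x where alg: "\<And>y. algebraic_over (ratfuns_in \<iota> x) y"
    using trdeg unfolding trdeg_one_def by blast
  obtain d cs where cs: "(\<Sum>i\<le>d. ev (cs i) x * y ^ i) = 0" "ev (cs d) x \<noteq> 0" "d > 0"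
    using algebraic_over_ratfuns_relation[OF alg] .
  obtain m es where es: "(\<Sum>i\<le>m. ev (es i) x * z ^ i) = 0" "ev (es m) x \<noteq> 0" "m > 0"
    using algebraic_over_ratfuns_relation[OF alg] .
  define B where "B = Max ((\<lambda>i. degree (cs i)) ` {..d} \<union> (\<lambda>i. degree (es i)) ` {..m})"
  have B: "degree (cs i) \<le> B" if "i \<le> d" for i using that by (auto simp: B_def intro!: Max_ge)
  have B': "degree (es i) \<le> B" if "i \<le> m" for i using that by (auto simp: B_def intro!: Max_ge)
  \<comment> \<open>Large enough for \<open>(2 * B * N + 1) * (d * m) < (N + 1)\<^sup>2\<close>.\<close>
  define N where "N = (2 * B + 1) * (d * m)"
  have "\<forall>n\<in>{..N}. \<exists>p. ev (cs d) x ^ N * y ^ n = (\<Sum>i<d. ev (p i) x * y ^ i)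
      \<and> (\<forall>i<d. degree (p i) \<le> B * N)"
    using reduce_power[OF cs(1,3) B] by auto
  from bchoice[OF this] obtain p where p: "\<And>n. n \<le> N \<Longrightarrow> ev (cs d) x ^ N * y ^ n = (\<Sum>i<d. ev (p n i) x * y ^ i)"
      "\<And>n i. n \<le> N \<Longrightarrow> i < d \<Longrightarrow> degree (p n i) \<le> B * N"
    by auto
  have "\<forall>n\<in>{..N}. \<exists>q. ev (es m) x ^ N * z ^ n = (\<Sum>i<m. ev (q i) x * z ^ i)
      \<and> (\<forall>i<m. degree (q i) \<le> B * N)"
    using reduce_power[OF es(1,3) B'] by auto
  from bchoice[OF this] obtain q where q: "\<And>n. n \<le> N \<Longrightarrow> ev (es m) x ^ N * z ^ n = (\<Sum>i<m. ev (q n i) x * z ^ i)"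
      "\<And>n i. n \<le> N \<Longrightarrow> i < m \<Longrightarrow> degree (q n i) \<le> B * N"
    by auto
  define M where "M = 2 * B * N"
  define I where "I = {..N} \<times> {..N}"
  define J where "J = {..M} \<times> {..<d} \<times> {..<m}"
  define A where "A = (\<lambda>ij akl. coeff (p (fst ij) (fst (snd akl)) * q (snd ij) (snd (snd akl))) (fst akl))"
  have deg: "degree (p i k * q j l) \<le> M" if "i \<le> N" "j \<le> N" "k < d" "l < m" for i j k l
    using degree_mult_le[of "p i k" "q j l"] p(2)[of i k] q(2)[of j l] that by (simp add: M_def)
  have "(M + 1) * (d * m) \<le> N * N + N"
  proof -
    have "(M + 1) * (d * m) = N * (2 * B * (d * m)) + d * m" by (simp add: M_def algebra_simps)
    also have "\<dots> \<le> N * N + N" by (intro add_mono mult_left_mono) (auto simp: N_def)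
    finally show ?thesis .
  qed
  then have "card J < card I" by (simp add: I_def J_def card_cartesian_product)
  moreover have "finite I" "finite J" by (auto simp: I_def J_def)
  ultimately obtain l where l: "\<exists>ij\<in>I. l ij \<noteq> 0" "\<forall>akl\<in>J. (\<Sum>ij\<in>I. l ij * A ij akl) = 0"
    using underdetermined_system[of J I A] by blast
  define c where "c = ev (cs d) x ^ N * ev (es m) x ^ N"
  have "c \<noteq> 0" using cs es by (simp add: c_def)
  have mono: "c * (y ^ i * z ^ j) = (\<Sum>akl\<in>J. \<iota> (A (i, j) akl) *
      (x ^ fst akl * y ^ fst (snd akl) * z ^ snd (snd akl)))" if "(i, j) \<in> I" for i j
  proof -
    have ij: "i \<le> N" "j \<le> N" using that by (auto simp: I_def)
    have "c * (y ^ i * z ^ j) = (ev (cs d) x ^ N * y ^ i) * (ev (es m) x ^ N * z ^ j)"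
      by (simp add: c_def mult.commute mult.left_commute)
    also have "\<dots> = (\<Sum>k<d. \<Sum>l<m. ev (p i k * q j l) x * y ^ k * z ^ l)"
      unfolding p(1)[OF ij(1)] q(1)[OF ij(2)] sum_product
      by (intro sum.cong) (auto simp: ev_mult mult.commute mult.left_commute)
    also have "\<dots> = (\<Sum>k<d. \<Sum>l<m. \<Sum>a\<le>M. \<iota> (A (i, j) (a, k, l)) * (x ^ a * y ^ k * z ^ l))"
      using ev_altdef[OF deg[OF ij]]
      by (intro sum.cong) (auto simp: A_def sum_distrib_right mult.assoc)
    also have "\<dots> = (\<Sum>kl\<in>{..<d}\<times>{..<m}. \<Sum>a\<le>M. \<iota> (A (i, j) (a, kl)) * (x ^ a * y ^ fst kl * z ^ snd kl))"
    proof -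
      have "(\<Sum>k<d. \<Sum>l<m. \<Sum>a\<le>M. \<iota> (A (i, j) (a, k, l)) * (x ^ a * y ^ k * z ^ l))
          = (\<Sum>(k, l)\<in>{..<d}\<times>{..<m}. \<Sum>a\<le>M. \<iota> (A (i, j) (a, k, l)) * (x ^ a * y ^ k * z ^ l))"
        by (rule sum.cartesian_product)
      also have "\<dots> = (\<Sum>kl\<in>{..<d}\<times>{..<m}. \<Sum>a\<le>M. \<iota> (A (i, j) (a, kl)) * (x ^ a * y ^ fst kl * z ^ snd kl))"
        by (intro sum.cong) auto
      finally show ?thesis .
    qed
    also have "\<dots> = (\<Sum>a\<le>M. \<Sum>kl\<in>{..<d}\<times>{..<m}. \<iota> (A (i, j) (a, kl)) * (x ^ a * y ^ fst kl * z ^ snd kl))"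
      by (rule sum.swap)
    finally show ?thesis
      by (simp add: J_def sum.cartesian_product case_prod_beta)
  qed
  have "c * (\<Sum>ij\<in>I. \<iota> (l ij) * (y ^ fst ij * z ^ snd ij))
      = (\<Sum>ij\<in>I. \<iota> (l ij) * (c * (y ^ fst ij * z ^ snd ij)))"
    by (simp add: sum_distrib_left mult.left_commute)
  also have "\<dots> = (\<Sum>ij\<in>I. \<Sum>akl\<in>J. \<iota> (l ij * A ij akl) *
      (x ^ fst akl * y ^ fst (snd akl) * z ^ snd (snd akl)))"
    by (intro sum.cong) (auto simp: mono sum_distrib_left iota_mult mult.assoc)
  also have "\<dots> = (\<Sum>akl\<in>J. \<Sum>ij\<in>I. \<iota> (l ij * A ij akl) *
      (x ^ fst akl * y ^ fst (snd akl) * z ^ snd (snd akl)))"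
    by (rule sum.swap)
  also have "\<dots> = (\<Sum>akl\<in>J. \<iota> (\<Sum>ij\<in>I. l ij * A ij akl) *
      (x ^ fst akl * y ^ fst (snd akl) * z ^ snd (snd akl)))"
    by (simp add: iota_sum sum_distrib_right)
  also have "\<dots> = 0" using l(2) by simp
  finally have zero: "(\<Sum>ij\<in>I. \<iota> (l ij) * (y ^ fst ij * z ^ snd ij)) = 0" using \<open>c \<noteq> 0\<close> by simp
  define F where "F = (\<Sum>ij\<in>I. monom (monom (l ij) (fst ij)) (snd ij))"
  have "ev2 F y z = 0" using zero by (simp add: F_def ev2_sum mult.assoc)
  moreover have "F \<noteq> 0"
  proof -
    obtain i j where ij: "(i, j) \<in> I" "l (i, j) \<noteq> 0" using l(1) by auto
    have "coeff (coeff F j) i = (\<Sum>ab\<in>I. if ab = (i, j) then l (i, j) else 0)"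
      unfolding F_def coeff_sum by (intro sum.cong) auto
    also have "\<dots> = l (i, j)" using ij \<open>finite I\<close> by simp
    finally show ?thesis using ij by auto
  qed
  ultimately have fin: "F \<noteq> 0 \<and> ev2 F y z = 0" by simp
  show ?thesis by (rule exI[of _ F], rule fin)
qed

text \<open>
  Take a relation between \<open>y\<close> and \<open>g\<close> and divide it by the highest possible power of \<open>g\<close>. What remains
  is \<open>P(y) + g * G(y, g) = 0\<close> with \<open>P \<noteq> 0\<close>.
\<close>

lemma polynomial_multiple:
  assumes "g \<noteq> 0"
  shows "\<exists>P. P \<noteq> 0 \<and> (\<forall>B. subalgebra \<iota> B \<longrightarrow> y \<in> B \<longrightarrow> g \<in> B \<longrightarrow> (\<exists>r\<in>B. ev P y = g * r))"
proof -
  have "\<exists>P. P \<noteq> 0 \<and> (\<exists>G. ev2 (pCons P G) y g = 0)" if "F \<noteq> 0" "ev2 F y g = 0" for F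
    using that
  proof (induction F)
    case (pCons P G)
    show ?case
    proof (cases "P = 0")
      case True
      with pCons have "G \<noteq> 0" "ev2 G y g = 0" using assms by auto
      then show ?thesis by (rule pCons.IH)
    next
      case False
      with pCons.prems show ?thesis by blast
    qed
  qed simp
  then obtain P G where PG: "P \<noteq> 0" "ev2 (pCons P G) y g = 0"
    using algebraically_dependent[of y g] by blast
  have "\<exists>r\<in>B. ev P y = g * r" if "subalgebra \<iota> B" "y \<in> B" "g \<in> B" for B
    using PG(2) subalgebra_ev2[OF that, of G] that(1)
    by (intro bexI[of _ "- ev2 G y g"]) (auto simp: subalgebra_closed eq_neg_iff_add_eq_0)
  with PG show ?thesis by blast
qed

text \<open>
  Differentiate a relation \<open>F(y, g) = 0\<close> of least degree in \<open>g\<close>: the partial derivative of \<open>F\<close> with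
  respect to \<open>g\<close> has smaller degree and hence does not vanish at \<open>(y, g)\<close>, being a nonzero polynomial because \<open>y\<close> is
  transcendental. So \<open>\<delta> g\<close> can be solved for.
\<close>

lemma derivation_multiple:
  fixes \<phi> \<delta> :: "'k \<Rightarrow> 'l::field"
  assumes \<phi>: "\<And>a b. \<phi> (a + b) = \<phi> a + \<phi> b" "\<And>a b. \<phi> (a * b) = \<phi> a * \<phi> b" "\<phi> 1 = 1"
    and \<delta>: "\<And>a b. \<delta> (a + b) = \<delta> a + \<delta> b" "\<And>c. \<delta> (\<iota> c) = 0"
      "\<And>a b. \<delta> (a * b) = \<phi> a * \<delta> b + \<phi> b * \<delta> a"
    and y: "y \<notin> range \<iota>"
  shows "\<exists>r. \<delta> g = \<phi> r * \<delta> y"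
proof -
  obtain F where F: "F \<noteq> 0" "ev2 F y g = 0"
    and min: "\<And>G. G \<noteq> 0 \<Longrightarrow> ev2 G y g = 0 \<Longrightarrow> degree F \<le> degree G"
    using ex_has_least_nat[of "\<lambda>F. F \<noteq> 0 \<and> ev2 F y g = 0" _ degree] algebraically_dependent[of y g]
    by metis
  have "degree F \<noteq> 0"
  proof
    assume "degree F = 0"
    then obtain P where "F = [:P:]" by (metis degree_eq_zeroE)
    with F nonconstant_ev_nonzero[OF y] show False by auto
  qed
  then have "pderiv F \<noteq> 0" "degree (pderiv F) < degree F"
    by (auto simp: pderiv_eq_0_iff degree_pderiv)
  then have b: "ev2 (pderiv F) y g \<noteq> 0" (is "?b \<noteq> 0") using min by force
  define a where "a = ev2 (map_poly pderiv F) y g"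
  have \<phi>0: "\<phi> 0 = 0" by (metis add_0 add_cancel_left_left \<phi>(1))
  have "\<delta> 0 = 0" using \<delta>(2)[of 0] by simp
  then have "\<phi> a * \<delta> y + \<phi> ?b * \<delta> g = 0"
    using derivation_ev2[where \<phi> = \<phi> and \<delta> = \<delta>, OF \<phi>(1,2) \<delta>, of F y g] F(2) by (simp add: a_def)
  moreover have inv: "\<phi> ?b * \<phi> (inverse ?b) = 1"
    using b \<phi>(2)[of ?b "inverse ?b"] \<phi>(3) by simp
  moreover have "\<phi> (- (a * inverse ?b)) = - (\<phi> a * \<phi> (inverse ?b))"
  proof -
    have "\<phi> (a * inverse ?b) + \<phi> (- (a * inverse ?b)) = 0" by (simp add: \<phi>0 flip: \<phi>(1))
    from minus_unique[OF this] show ?thesis by (simp only: \<phi>(2))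
  qed
  ultimately have eq: "\<phi> a * \<delta> y + \<phi> ?b * \<delta> g = 0" and inv: "\<phi> ?b * \<phi> (inverse ?b) = 1"
      and r: "\<phi> (- (a * inverse ?b)) = - (\<phi> a * \<phi> (inverse ?b))" .
  have "\<delta> g = (\<phi> ?b * \<phi> (inverse ?b)) * \<delta> g" unfolding inv by simp
  also have "\<dots> = \<phi> (inverse ?b) * (\<phi> ?b * \<delta> g)" by (simp only: mult_ac)
  also have "\<phi> ?b * \<delta> g = - (\<phi> a * \<delta> y)" using minus_unique[OF eq] by simp
  also have "\<phi> (inverse ?b) * - (\<phi> a * \<delta> y) = \<phi> (- (a * inverse ?b)) * \<delta> y"
    unfolding r by simp
  finally show ?thesis by blast
qed

end

section \<open>Laurent expansions at a regular point\<close>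

text \<open>
  Both \<open>val_at q\<close> and \<open>fls_subdegree\<close> are \<open>0\<close> at \<open>0\<close>, so the last two conditions hold without exception.
\<close>

locale expansion = complex_field_extension \<iota>
  for \<iota> :: "complex \<Rightarrow> 'k::field" +
  fixes q :: "'k set" and t :: 'k and \<phi> :: "'k \<Rightarrow> complex fls"
  assumes hom_add: "\<phi> (a + b) = \<phi> a + \<phi> b"
    and hom_mult: "\<phi> (a * b) = \<phi> a * \<phi> b"
    and hom_iota: "\<phi> (\<iota> c) = fls_const c"
    and hom_param: "\<phi> t = fls_X"
    and val_eq: "val_at q g = fls_subdegree (\<phi> g)"
    and mem_iff: "g \<in> q \<longleftrightarrow> 0 \<le> fls_subdegree (\<phi> g)"
begin

lemma hom_0 [simp]: "\<phi> 0 = 0" and hom_1 [simp]: "\<phi> 1 = 1"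
  using hom_iota[of 0] hom_iota[of 1] by auto

lemma hom_eq_0_iff [simp]: "\<phi> g = 0 \<longleftrightarrow> g = 0"
proof
  assume "\<phi> g = 0"
  then show "g = 0" using hom_mult[of g "inverse g"] by (cases "g = 0") auto
qed simp

lemma hom_uminus: "\<phi> (- a) = - \<phi> a"
  using minus_unique[of "\<phi> a" "\<phi> (- a)"] by (simp flip: hom_add)

lemma hom_diff: "\<phi> (a - b) = \<phi> a - \<phi> b"
  using hom_add[of a "- b"] by (simp add: hom_uminus)

lemma hom_inj: "\<phi> a = \<phi> b \<Longrightarrow> a = b"
  using hom_eq_0_iff[of "a - b"] by (simp add: hom_diff del: hom_eq_0_iff)

lemma hom_power: "\<phi> (a ^ n) = \<phi> a ^ n"
  by (induction n) (auto simp: hom_mult)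

lemma hom_sum: "\<phi> (sum g S) = (\<Sum>i\<in>S. \<phi> (g i))"
  by (induction S rule: infinite_finite_induct) (auto simp: hom_add)

lemma hom_inverse: "\<phi> (inverse a) = inverse (\<phi> a)"
proof (cases "a = 0")
  case False
  then have "\<phi> a * \<phi> (inverse a) = 1" by (simp flip: hom_mult)
  then show ?thesis by (metis inverse_unique)
qed simp

lemma hom_divide: "\<phi> (a / b) = \<phi> a / \<phi> b"
  by (simp add: divide_inverse hom_mult hom_inverse)

lemma param_nonconstant: "t \<notin> range \<iota>"
proof
  assume "t \<in> range \<iota>"
  then have "fls_subdegree (\<phi> t) = 0" by (auto simp: hom_iota)
  then show False by (simp add: hom_param)
qed

end

lemma val_at_eqI:
  assumes "discrete_valuation v" "q = {g. g = 0 \<or> 0 \<le> v g}"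
  shows "val_at q = v"
  unfolding val_at_def
  by (rule the_equality) (use assms discrete_valuation_unique in blast)+

locale regular_point = complex_function_field \<iota>
  for \<iota> :: "complex \<Rightarrow> 'k::field" +
  fixes q :: "'k set" and t :: 'k
  assumes subalg: "subalgebra \<iota> q" and fraction: "has_fraction_field_UNIV q"
    and t_nonzero: "t \<noteq> 0" and nonunits_eq: "nonunits q = {t * a | a. a \<in> q}"
begin

lemmas closed = subalgebra_closed[OF subalg]

lemma nonunit_iff: "a \<in> nonunits q \<longleftrightarrow> (\<exists>b\<in>q. a = t * b)"
  using nonunits_eq by blast

lemma nonunit_add: "a \<in> nonunits q \<Longrightarrow> b \<in> nonunits q \<Longrightarrow> a + b \<in> nonunits q"
  unfolding nonunit_iff by (metis closed(2) distrib_left)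

lemma nonunit_mult: "a \<in> q \<Longrightarrow> b \<in> nonunits q \<Longrightarrow> a * b \<in> nonunits q"
  unfolding nonunit_iff by (metis closed(3) mult.left_commute)

lemma nonunit_diff: "a \<in> nonunits q \<Longrightarrow> b \<in> nonunits q \<Longrightarrow> a - b \<in> nonunits q"
  using nonunit_add[of a "- b"] nonunit_mult[of "- 1" b] closed(4)[OF closed(6)] by simp

lemma nonunit_mem: "a \<in> nonunits q \<Longrightarrow> a \<in> q"
  by (simp add: nonunits_def)

lemma zero_nonunit: "0 \<in> nonunits q"
  using closed(7) by (simp add: nonunits_def)

lemma iota_nonunit_iff: "\<iota> c \<in> nonunits q \<longleftrightarrow> c = 0"
  using closed(1)[of "inverse c"] closed(1)[of c] by (auto simp: nonunits_def iota_inverse)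

lemma t_nonunit: "t \<in> nonunits q" and t_mem: "t \<in> q"
proof -
  show "t \<in> nonunits q" unfolding nonunit_iff using closed(6) by (intro bexI[of _ 1]) auto
  then show "t \<in> q" by (rule nonunit_mem)
qed

text \<open>
  If no \<open>z - c\<close> were in the maximal ideal, every nonzero polynomial would take a unit as its value at \<open>z\<close>. But by
  \<open>polynomial_multiple\<close> the value at \<open>z\<close> of some such polynomial is a multiple of \<open>t\<close>.
\<close>

lemma residue_exists:
  assumes "z \<in> q"
  shows "\<exists>c. z - \<iota> c \<in> nonunits q"
proof (rule ccontr)
  assume no: "\<nexists>c. z - \<iota> c \<in> nonunits q"
  obtain P where P: "P \<noteq> 0" "\<exists>r\<in>q. ev P z = t * r"
    using polynomial_multiple[OF t_nonzero, of z] subalg assms t_mem by blast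
  have "ev P z \<in> q - nonunits q"
  proof (rule ev_split_mem[OF P(1)])
    show "\<iota> c \<in> q - nonunits q" if "c \<noteq> 0" for c using that iota_nonunit_iff closed by auto
    show "z - \<iota> r \<in> q - nonunits q" for r using no assms closed by auto
    show "a * b \<in> q - nonunits q" if "a \<in> q - nonunits q" "b \<in> q - nonunits q" for a b
      using that closed(3)[of a b] closed(3)[of "inverse a" "inverse b"]
      by (auto simp: nonunits_def)
  qed
  with P show False by (auto simp: nonunit_iff)
qed

definition res :: "'k \<Rightarrow> complex" where
  "res z = (THE c. z - \<iota> c \<in> nonunits q)"

lemma residue_unique:
  assumes "z - \<iota> c \<in> nonunits q" "z - \<iota> d \<in> nonunits q"
  shows "c = d"
  using nonunit_diff[OF assms] iota_nonunit_iff[of "d - c"] by (simp add: iota_diff)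

lemma res_eqI: "z - \<iota> c \<in> nonunits q \<Longrightarrow> res z = c"
  unfolding res_def using residue_unique by blast

lemma res_nonunit: "z \<in> q \<Longrightarrow> z - \<iota> (res z) \<in> nonunits q"
  using residue_exists res_eqI by metis

text \<open>
  The \<open>n\<close>-th coefficient of the expansion is the residue left after removing the first \<open>n\<close> terms and
  dividing by \<open>t ^ n\<close>.
\<close>

definition shift :: "'k \<Rightarrow> 'k" where
  "shift z = (z - \<iota> (res z)) / t"

lemma shift_mem: "z \<in> q \<Longrightarrow> shift z \<in> q"
  using res_nonunit[of z] t_nonzero by (auto simp: nonunit_iff shift_def)

lemma split_shift: "z = \<iota> (res z) + t * shift z"
  using t_nonzero by (simp add: shift_def)

lemma split_shift_add: "a + b = \<iota> (res a + res b) + t * (shift a + shift b)"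
proof -
  have "a + b = (\<iota> (res a) + t * shift a) + (\<iota> (res b) + t * shift b)"
    by (simp only: split_shift[symmetric])
  then show ?thesis by (simp add: iota_add distrib_left add_ac)
qed

lemma split_shift_mult:
  "a * b = \<iota> (res a * res b) + t * (\<iota> (res a) * shift b + shift a * b)"
proof -
  have "a * b = (\<iota> (res a) + t * shift a) * b" by (simp only: split_shift[symmetric])
  also have "\<dots> = \<iota> (res a) * b + t * shift a * b" by (rule distrib_right)
  also have "\<dots> = \<iota> (res a) * (\<iota> (res b) + t * shift b) + t * shift a * b"
    by (simp only: split_shift[symmetric])
  finally show ?thesis by (simp add: iota_mult distrib_left add_ac mult_ac)
qed

lemma res_shiftI:
  assumes "z = \<iota> c + t * w" "w \<in> q"
  shows "res z = c" "shift z = w"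
proof -
  show "res z = c" using assms by (intro res_eqI) (auto simp: nonunit_iff)
  then show "shift z = w" using assms t_nonzero by (simp add: shift_def)
qed

definition series :: "'k \<Rightarrow> complex fps" where
  "series z = Abs_fps (\<lambda>n. res ((shift ^^ n) z))"

lemma series_rec: "series z = fps_const (res z) + fps_X * series (shift z)"
proof (rule fps_ext)
  fix n show "series z $ n = (fps_const (res z) + fps_X * series (shift z)) $ n"
    by (cases n) (simp_all add: series_def funpow_swap1)
qed

lemma series_nth_0: "series z $ 0 = res z"
  and series_nth_Suc: "series z $ Suc n = series (shift z) $ n"
  by (simp_all add: series_def funpow_swap1)

lemma series_add:
  assumes "a \<in> q" "b \<in> q"
  shows "series (a + b) = series a + series b"
proof (rule fps_ext)
  fix n show "series (a + b) $ n = (series a + series b) $ n"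
    using assms
  proof (induction n arbitrary: a b)
    case (0 a b)
    from res_shiftI[OF split_shift_add] show ?case using 0 by (simp add: series_nth_0 closed shift_mem)
  next
    case (Suc n a b)
    from res_shiftI[OF split_shift_add] show ?case using Suc by (simp add: series_nth_Suc closed shift_mem)
  qed
qed

lemma series_0 [simp]: "series 0 = 0"
  using series_add[of 0 0] closed(7) by simp

lemma series_iota: "series (\<iota> c) = fps_const c"
  using series_rec[of "\<iota> c"] res_shiftI[of "\<iota> c" c 0] closed by simp

lemma series_mult:
  assumes "a \<in> q" "b \<in> q"
  shows "series (a * b) = series a * series b"
proof (rule fps_ext)
  fix n show "series (a * b) $ n = (series a * series b) $ n"
    using assms
  proof (induction n arbitrary: a b)
    case (0 a b)
    from res_shiftI[OF split_shift_mult] show ?case using 0 by (simp add: series_nth_0 closed shift_mem)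
  next
    case (Suc n a b)
    from res_shiftI[OF split_shift_mult] have "shift (a * b) = \<iota> (res a) * shift b + shift a * b"
      using Suc.prems by (simp add: closed shift_mem)
    then have "series (a * b) $ Suc n = (series (\<iota> (res a) * shift b) + series (shift a * b)) $ n"
      using Suc.prems by (simp add: series_nth_Suc series_add closed shift_mem)
    also have "\<dots> = (series (\<iota> (res a)) * series (shift b)) $ n + (series (shift a) * series b) $ n"
      using Suc.IH[of "\<iota> (res a)" "shift b"] Suc.IH[of "shift a" b] Suc.prems
      by (simp add: closed shift_mem)
    also have "\<dots> = res a * series b $ Suc n + (series (shift a) * series b) $ n"
      by (simp add: series_iota series_nth_Suc)
    also have "\<dots> = ((fps_const (res a) + fps_X * series (shift a)) * series b) $ Suc n"
      by (simp add: distrib_right mult.assoc)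
    also have "\<dots> = (series a * series b) $ Suc n" by (simp only: series_rec[symmetric])
    finally show ?case .
  qed
qed

lemma series_t: "series t = fps_X"
  using series_rec[of t] res_shiftI[of t 0 1] closed series_iota[of 1] by simp

lemma series_ev: "series (ev P t) = fps_of_poly P"
  by (induction P)
    (simp_all add: fps_of_poly_pCons series_add series_mult series_iota series_t
      subalgebra_ev[OF subalg] closed t_mem mult.commute)

text \<open>
  A nonzero \<open>z\<close> divides some \<open>P(t)\<close> with \<open>P \<noteq> 0\<close>, whose expansion is \<open>P\<close> itself. This takes the place
  of the Krull intersection theorem.
\<close>

lemma series_eq_0_iff:
  assumes "z \<in> q"
  shows "series z = 0 \<longleftrightarrow> z = 0"
proof
  assume z: "series z = 0"
  show "z = 0"
  proof (rule ccontr)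
    assume "z \<noteq> 0"
    from polynomial_multiple[OF this, of t] obtain P r where "P \<noteq> 0" "r \<in> q" "ev P t = z * r"
      using subalg assms t_mem by blast
    then have "fps_of_poly P = 0" using z assms by (simp add: series_mult flip: series_ev)
    with \<open>P \<noteq> 0\<close> show False by simp
  qed
qed simp

lemma unit_factorization:
  assumes "z \<in> q" "z \<noteq> 0"
  shows "\<exists>u. u \<in> q \<and> u \<notin> nonunits q \<and> z = t ^ subdegree (series z) * u"
  using assms
proof (induction "subdegree (series z)" arbitrary: z rule: less_induct)
  case (less z)
  show ?case
  proof (cases "z \<in> nonunits q")
    case False
    then have "res z \<noteq> 0" using res_nonunit[OF less.prems(1)] by auto
    then have "subdegree (series z) = 0" by (intro subdegree_eq_0) (simp add: series_nth_0)
    with False less.prems show ?thesis by auto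
  next
    case True
    then obtain w where w: "w \<in> q" "z = t * w" by (auto simp: nonunit_iff)
    then have "w \<noteq> 0" using less.prems by auto
    then have "subdegree (series z) = Suc (subdegree (series w))"
      using w t_mem by (simp add: series_mult series_t series_eq_0_iff)
    then show ?thesis using less.hyps[of w] w \<open>w \<noteq> 0\<close> by auto
  qed
qed

text \<open>
  The extension of \<open>series\<close> to the fraction field; \<open>expand_fraction\<close> shows that it does not depend on
  the chosen fraction.
\<close>

definition expand :: "'k \<Rightarrow> complex fls" where
  "expand g = (let (a, b) = SOME (a, b). a \<in> q \<and> b \<in> q \<and> b \<noteq> 0 \<and> g = a / b
     in fps_to_fls (series a) / fps_to_fls (series b))"

lemma fraction_obtain:
  obtains a b where "a \<in> q" "b \<in> q" "b \<noteq> 0" "g = a / b"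
  using fraction unfolding has_fraction_field_UNIV_def by blast

lemma expand_fraction:
  assumes "a \<in> q" "b \<in> q" "b \<noteq> 0"
  shows "expand (a / b) = fps_to_fls (series a) / fps_to_fls (series b)"
proof -
  define cd where "cd = (SOME (c, d). c \<in> q \<and> d \<in> q \<and> d \<noteq> 0 \<and> a / b = c / d)"
  have "case cd of (c, d) \<Rightarrow> c \<in> q \<and> d \<in> q \<and> d \<noteq> 0 \<and> a / b = c / d"
    unfolding cd_def by (rule someI[of _ "(a, b)"]) (use assms in auto)
  then obtain c d where cd: "cd = (c, d)" "c \<in> q" "d \<in> q" "d \<noteq> 0" "a / b = c / d"
    by (cases cd) auto
  then have "a * d = c * b" using assms by (simp add: field_simps)
  then have "series a * series d = series c * series b"
    using assms cd by (simp flip: series_mult)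
  then have "fps_to_fls (series a) * fps_to_fls (series d) = fps_to_fls (series c) * fps_to_fls (series b)"
    by (simp flip: fls_times_fps_to_fls)
  moreover have "fps_to_fls (series b) \<noteq> 0" "fps_to_fls (series d) \<noteq> 0"
    using assms cd by (simp_all add: series_eq_0_iff)
  ultimately have "fps_to_fls (series a) / fps_to_fls (series b)
      = fps_to_fls (series c) / fps_to_fls (series d)"
    by (simp add: frac_eq_eq)
  moreover have "expand (a / b) = fps_to_fls (series c) / fps_to_fls (series d)"
    unfolding expand_def cd_def[symmetric] cd(1) by simp
  ultimately show ?thesis by simp
qed

lemma expand_mem: "a \<in> q \<Longrightarrow> expand a = fps_to_fls (series a)"
  using expand_fraction[of a 1] closed(6) series_iota[of 1] by simp

lemma expand_mult: "expand (g * h) = expand g * expand h"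
proof -
  obtain a b c d where ab: "a \<in> q" "b \<in> q" "b \<noteq> 0" "g = a / b"
    and cd: "c \<in> q" "d \<in> q" "d \<noteq> 0" "h = c / d"
    using fraction_obtain by metis
  have "g * h = (a * c) / (b * d)" by (simp add: ab cd)
  then show ?thesis
    using expand_fraction[of "a * c" "b * d"] ab cd
    by (simp add: expand_fraction closed series_mult fls_times_fps_to_fls)
qed

lemma expand_add: "expand (g + h) = expand g + expand h"
proof -
  obtain a b c d where ab: "a \<in> q" "b \<in> q" "b \<noteq> 0" "g = a / b"
    and cd: "c \<in> q" "d \<in> q" "d \<noteq> 0" "h = c / d"
    using fraction_obtain by metis
  have "g + h = (a * d + c * b) / (b * d)" using ab cd by (simp add: add_frac_eq)
  moreover have "fps_to_fls (series b) \<noteq> 0" "fps_to_fls (series d) \<noteq> 0"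
    using ab cd by (simp_all add: series_eq_0_iff)
  ultimately show ?thesis
    using expand_fraction[of "a * d + c * b" "b * d"] ab cd
    by (simp add: expand_fraction closed series_mult series_add fls_times_fps_to_fls add_frac_eq)
qed

lemma expand_eq_0_iff: "expand g = 0 \<longleftrightarrow> g = 0"
proof
  assume "expand g = 0"
  moreover have "expand 1 = 1" using expand_mem[of 1] closed series_iota[of 1] by simp
  ultimately show "g = 0" using expand_mult[of g "inverse g"] by (cases "g = 0") auto
next
  assume "g = 0"
  then show "expand g = 0" using expand_mem[of 0] closed by simp
qed

lemma expand_t: "expand t = fls_X"
  using expand_mem[OF t_mem] series_t by simp

lemma expand_mem_iff: "g \<in> q \<longleftrightarrow> 0 \<le> fls_subdegree (expand g)"
proof
  assume "g \<in> q"
  then show "0 \<le> fls_subdegree (expand g)" by (simp add: expand_mem fls_subdegree_fls_to_fps_gt0)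
next
  assume nn: "0 \<le> fls_subdegree (expand g)"
  show "g \<in> q"
  proof (cases "g = 0")
    case False
    obtain a b where ab: "a \<in> q" "b \<in> q" "b \<noteq> 0" "g = a / b" using fraction_obtain .
    with False have "a \<noteq> 0" by auto
    define m n where "m = subdegree (series a)" "n = subdegree (series b)"
    obtain u where u: "u \<in> q" "u \<notin> nonunits q" "a = t ^ m * u"
      using unit_factorization[of a] ab \<open>a \<noteq> 0\<close> m_n_def by auto
    obtain w where w: "w \<in> q" "w \<notin> nonunits q" "b = t ^ n * w"
      using unit_factorization[of b] ab m_n_def by auto
    have "fls_subdegree (expand g) = int m - int n"
      using ab \<open>a \<noteq> 0\<close> by (simp add: expand_fraction fls_divide_subdegree series_eq_0_iff
          fls_subdegree_fls_to_fps m_n_def)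
    with nn have "n \<le> m" by simp
    then have "g = t ^ (m - n) * (u * inverse w)"
      using ab u w t_nonzero by (simp add: power_diff field_simps)
    moreover have "inverse w \<in> q" using w by (auto simp: nonunits_def)
    ultimately show ?thesis using closed u t_mem by simp
  qed (simp add: closed)
qed

lemma expand_inverse: "expand (inverse g) = inverse (expand g)"
proof (cases "g = 0")
  case False
  have "expand 1 = 1" using expand_mem[of 1] closed series_iota[of 1] by simp
  then have "expand g * expand (inverse g) = 1" using False by (simp flip: expand_mult)
  then show ?thesis by (metis inverse_unique)
qed (use expand_eq_0_iff[of 0] in simp)

lemma discrete_valuation_expand: "discrete_valuation (\<lambda>g. fls_subdegree (expand g))"
  unfolding discrete_valuation_def
proof (intro conjI allI impI)
  show "fls_subdegree (expand 0) = 0" using expand_eq_0_iff[of 0] by simp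
  have pow: "expand (t ^ n) = fls_X ^ n" for n
    using expand_mem[of 1] closed series_iota[of 1] by (induction n) (simp_all add: expand_mult expand_t)
  have "\<exists>g. g \<noteq> 0 \<and> k = fls_subdegree (expand g)" for k
  proof (cases "0 \<le> k")
    case True
    then show ?thesis using pow[of "nat k"] t_nonzero by (intro exI[of _ "t ^ nat k"]) auto
  next
    case False
    then show ?thesis using pow[of "nat (- k)"] t_nonzero
      by (intro exI[of _ "inverse (t ^ nat (- k))"]) (auto simp: expand_inverse)
  qed
  then show "(\<lambda>g. fls_subdegree (expand g)) ` (- {0}) = UNIV" by blast
  show "fls_subdegree (expand (a * b)) = fls_subdegree (expand a) + fls_subdegree (expand b)"
    if "a \<noteq> 0" "b \<noteq> 0" for a b using that expand_eq_0_iff by (simp add: expand_mult)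
  show "min (fls_subdegree (expand a)) (fls_subdegree (expand b)) \<le> fls_subdegree (expand (a + b))"
    if "a + b \<noteq> 0" for a b
    using fls_plus_subdegree[of "expand a" "expand b"] that expand_eq_0_iff[of "a + b"]
    by (simp add: expand_add)
qed

lemma val_at_expand: "val_at q = (\<lambda>g. fls_subdegree (expand g))"
proof (rule val_at_eqI[OF discrete_valuation_expand])
  show "q = {g. g = 0 \<or> 0 \<le> fls_subdegree (expand g)}"
    using expand_mem_iff closed(7) by auto
qed

lemma expansion_expand: "expansion \<iota> q t expand"
  by unfold_locales
    (simp_all add: expand_add expand_mult expand_mem closed series_iota expand_t val_at_expand flip: expand_mem_iff)

text \<open>
  A local parameter in the sense of the valuation generates the maximal ideal, so expansions exist
  with respect to every local parameter and not only the given generator.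
\<close>

lemma regular_point_local_parameter:
  assumes "local_parameter q s"
  shows "regular_point \<iota> q s"
proof -
  interpret expansion \<iota> q t expand by (rule expansion_expand)
  have s: "s \<noteq> 0" "fls_subdegree (expand s) = 1"
    using assms by (auto simp: local_parameter_def val_at_expand)
  have "g \<in> nonunits q \<longleftrightarrow> (\<exists>a\<in>q. g = s * a)" for g
  proof (cases "g = 0")
    case False
    have "g \<in> nonunits q \<longleftrightarrow> 1 \<le> fls_subdegree (expand g)"
      using False by (auto simp: nonunits_def mem_iff hom_inverse)
    also have "\<dots> \<longleftrightarrow> 0 \<le> fls_subdegree (expand (g / s))"
      using False s by (auto simp: hom_divide fls_divide_subdegree)
    also have "\<dots> \<longleftrightarrow> g / s \<in> q" by (simp add: mem_iff)
    also have "\<dots> \<longleftrightarrow> (\<exists>a\<in>q. g = s * a)" using s by (auto intro!: bexI[of _ "g / s"])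
    finally show ?thesis .
  qed (use zero_nonunit closed(7) in auto)
  then show ?thesis using s subalg fraction by unfold_locales auto
qed

lemma local_parameter_expansion:
  assumes "local_parameter q s"
  obtains \<phi> where "expansion \<iota> q s \<phi>"
  using regular_point.expansion_expand[OF regular_point_local_parameter[OF assms]] that by blast

end

section \<open>Points of an affine model\<close>

context complex_field_extension
begin

lemma ideal_closed:
  assumes "is_ideal A I"
  shows "I \<subseteq> A" "0 \<in> I" "a \<in> I \<Longrightarrow> b \<in> I \<Longrightarrow> a + b \<in> I" "c \<in> A \<Longrightarrow> b \<in> I \<Longrightarrow> c * b \<in> I"
  using assms unfolding is_ideal_def by blast+

lemma maximal_ideal_one:
  assumes "is_maximal_ideal A M"
  shows "1 \<notin> M"
proof
  assume "1 \<in> M"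
  then have "a \<in> M" if "a \<in> A" for a
    using assms that ideal_closed(4)[of A M a 1] by (auto simp: is_maximal_ideal_def)
  then show False using assms ideal_closed(1)[of A M] by (auto simp: is_maximal_ideal_def)
qed

lemma maximal_ideal_prime:
  assumes A: "subalgebra \<iota> A" and M: "is_maximal_ideal A M" and ab: "a \<in> A" "b \<in> A" "a * b \<in> M"
  shows "a \<in> M \<or> b \<in> M"
proof (rule disjCI)
  assume "b \<notin> M"
  note closed = subalgebra_closed[OF A]
  have I: "is_ideal A M" using M by (simp add: is_maximal_ideal_def)
  note ideal = ideal_closed[OF I]
  define J where "J = {m + c * b | m c. m \<in> M \<and> c \<in> A}"
  have "u + w \<in> J" if uw: "u \<in> J" "w \<in> J" for u w
  proof -
    obtain m c where "m \<in> M" "c \<in> A" "u = m + c * b" using uw(1) J_def by blast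
    moreover obtain m' c' where "m' \<in> M" "c' \<in> A" "w = m' + c' * b" using uw(2) J_def by blast
    ultimately show ?thesis unfolding J_def using ideal(3)[of m m'] closed(2)[of c c']
      by (intro CollectI exI[of _ "m + m'"] exI[of _ "c + c'"]) (auto simp: algebra_simps)
  qed
  moreover have "d * u \<in> J" if du: "d \<in> A" "u \<in> J" for d u
  proof -
    obtain m c where "m \<in> M" "c \<in> A" "u = m + c * b"
      using du(2) J_def by blast
    then show ?thesis unfolding J_def using du ideal(4)[of d m] closed(3)[of d c]
      by (intro CollectI exI[of _ "d * m"] exI[of _ "d * c"]) (auto simp: algebra_simps)
  qed
  moreover have "J \<subseteq> A" unfolding J_def using ideal(1) closed ab by auto
  moreover have MJ: "M \<subseteq> J"
    unfolding J_def using closed(7) by (intro subsetI CollectI, rule_tac x = x in exI) (auto intro!: exI[of _ 0])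
  ultimately have "is_ideal A J" unfolding is_ideal_def using ideal(2) by blast
  moreover have "b \<in> J" unfolding J_def using ideal(2) closed(6) by (intro CollectI exI[of _ 0] exI[of _ 1]) auto
  ultimately have "J = A" using M MJ \<open>b \<notin> M\<close> unfolding is_maximal_ideal_def by blast
  then have "1 \<in> J" using closed(6) by simp
  then obtain m c where mc: "m \<in> M" "c \<in> A" "1 = m + c * b" unfolding J_def by blast
  have "a = a * m + c * (a * b)" using mc(3) by (metis distrib_left mult.left_commute mult.right_neutral)
  moreover have "a * m + c * (a * b) \<in> M" using ideal mc ab by auto
  ultimately show "a \<in> M" by simp
qed

lemma localization_subalgebra:
  assumes A: "subalgebra \<iota> A" and M: "is_maximal_ideal A M"
  shows "subalgebra \<iota> (localization A M)" "A \<subseteq> localization A M"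
proof -
  note closed = subalgebra_closed[OF A]
  have nz: "b \<noteq> 0" if "b \<in> A - M" for b
    using that M ideal_closed(2)[of A M] by (auto simp: is_maximal_ideal_def)
  have prod: "b * d \<in> A - M" if "b \<in> A - M" "d \<in> A - M" for b d
    using that maximal_ideal_prime[OF A M, of b d] closed by blast
  show sub: "A \<subseteq> localization A M"
  proof
    fix a assume "a \<in> A"
    then show "a \<in> localization A M" unfolding localization_def
      using maximal_ideal_one[OF M] closed(6) by (intro CollectI exI[of _ a] exI[of _ 1]) auto
  qed
  have "a / b + c / d \<in> localization A M" "a / b * (c / d) \<in> localization A M"
    if "a \<in> A" "b \<in> A - M" "c \<in> A" "d \<in> A - M" for a b c d
  proof -
    have bd: "b * d \<in> A - M" using prod that by blast
    have "a / b + c / d = (a * d + c * b) / (b * d)" using nz[OF that(2)] nz[OF that(4)] by (rule add_frac_eq)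
    moreover have "a * d + c * b \<in> A" using that closed(2,3) by simp
    ultimately show "a / b + c / d \<in> localization A M" unfolding localization_def using bd by blast
    have "a / b * (c / d) = (a * c) / (b * d)" by simp
    moreover have "a * c \<in> A" using that closed(3) by simp
    ultimately show "a / b * (c / d) \<in> localization A M" unfolding localization_def using bd by blast
  qed
  moreover have "range \<iota> \<subseteq> localization A M" using sub closed(1) by blast
  ultimately show "subalgebra \<iota> (localization A M)"
    unfolding subalgebra_def by (auto simp: localization_def)
qed

lemma localization_nonunits:
  assumes A: "subalgebra \<iota> A" and M: "is_maximal_ideal A M" and "a \<in> A"
  shows "a \<in> nonunits (localization A M) \<longleftrightarrow> a \<in> M"
proof
  have I: "is_ideal A M" using M by (simp add: is_maximal_ideal_def)
  note ideal = ideal_closed[OF I]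
  assume a: "a \<in> nonunits (localization A M)"
  show "a \<in> M"
  proof (rule ccontr)
    assume "a \<notin> M"
    then have "inverse a \<in> localization A M" unfolding localization_def
      using \<open>a \<in> A\<close> subalgebra_1[OF A]
      by (intro CollectI exI[of _ 1] exI[of _ a]) (auto simp: inverse_eq_divide)
    with a \<open>a \<notin> M\<close> ideal(2) show False by (auto simp: nonunits_def)
  qed
next
  have I: "is_ideal A M" using M by (simp add: is_maximal_ideal_def)
  note ideal = ideal_closed[OF I]
  assume a: "a \<in> M"
  have "inverse a \<notin> localization A M" if "a \<noteq> 0"
  proof
    assume "inverse a \<in> localization A M"
    then obtain c d where cd: "c \<in> A" "d \<in> A - M" "inverse a = c / d"
      unfolding localization_def by blast
    then have "d = c * a" using that ideal(2) by (auto simp: field_simps)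
    with cd ideal(4)[of c a] a show False by auto
  qed
  then show "a \<in> nonunits (localization A M)"
    using localization_subalgebra(2)[OF A M] \<open>a \<in> A\<close> by (auto simp: nonunits_def)
qed

end

context regular_point
begin

lemma ev_res: "z \<in> q \<Longrightarrow> ev P z - \<iota> (poly P (res z)) \<in> nonunits q"
proof (induction P)
  case 0
  then show ?case using zero_nonunit by simp
next
  case (pCons a P)
  have "ev (pCons a P) z - \<iota> (poly (pCons a P) (res z))
      = z * (ev P z - \<iota> (poly P (res z))) + \<iota> (poly P (res z)) * (z - \<iota> (res z))"
    by (simp add: iota_add iota_mult algebra_simps)
  with pCons show ?case
    using nonunit_add nonunit_mult closed(1) res_nonunit by simp
qed

lemma res_root:
  assumes "z \<in> q" "ev P z \<in> nonunits q"
  shows "poly P (res z) = 0"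
  using nonunit_diff[OF assms(2) ev_res[OF assms(1), of P]] by (simp add: iota_nonunit_iff)

end

context complex_function_field
begin

lemma affine_point_regular:
  assumes "affine_model \<iota> A" "q \<in> affine_points A" "regular_dim_one q"
  shows "\<exists>t. regular_point \<iota> q t"
proof -
  have A: "subalgebra \<iota> A" "has_fraction_field_UNIV A" using assms(1) by (auto simp: affine_model_def)
  obtain M where M: "is_maximal_ideal A M" "q = localization A M"
    using assms(2) by (auto simp: affine_points_def)
  note loc = localization_subalgebra[OF A(1) M(1), folded M(2)]
  have "has_fraction_field_UNIV q" using A(2) loc(2) unfolding has_fraction_field_UNIV_def by blast
  moreover obtain t where "t \<noteq> 0" "nonunits q = {t * a | a. a \<in> q}"
    using assms(3) by (auto simp: regular_dim_one_def)
  ultimately have "regular_point \<iota> q t" using loc(1) by unfold_locales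
  then show ?thesis by blast
qed

lemma generated_subset:
  assumes "A = \<Inter>{B. subalgebra \<iota> B \<and> S \<subseteq> B}" "subalgebra \<iota> B" "S \<subseteq> B"
  shows "A \<subseteq> B"
  using assms by blast

text \<open>
  The elements whose residues at \<open>q\<close> and \<open>q'\<close> agree form a subalgebra. Containing the generators, it contains
  \<open>A\<close>, so the two maximal ideals of \<open>A\<close>, which consist of the elements with residue \<open>0\<close>, coincide.
\<close>

lemma residues_inj:
  assumes A: "subalgebra \<iota> A" "A = \<Inter>{B. subalgebra \<iota> B \<and> S \<subseteq> B}"
    and q: "q \<in> affine_points A" "regular_point \<iota> q t"
    and q': "q' \<in> affine_points A" "regular_point \<iota> q' t'"
    and eq: "\<And>s. s \<in> S \<Longrightarrow> regular_point.res \<iota> q s = regular_point.res \<iota> q' s"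
  shows "q = q'"
proof -
  interpret q: regular_point \<iota> q t by fact
  interpret q': regular_point \<iota> q' t' by fact
  obtain M where M: "is_maximal_ideal A M" "q = localization A M"
    using q by (auto simp: affine_points_def)
  obtain M' where M': "is_maximal_ideal A M'" "q' = localization A M'"
    using q' by (auto simp: affine_points_def)
  have Aq: "A \<subseteq> q" "A \<subseteq> q'"
    using localization_subalgebra(2)[OF A(1)] M M' by auto
  define B where "B = {a\<in>q \<inter> q'. \<exists>c. a - \<iota> c \<in> nonunits q \<and> a - \<iota> c \<in> nonunits q'}"
  have "subalgebra \<iota> B"
    unfolding subalgebra_def
  proof (intro conjI ballI subsetI)
    fix z assume "z \<in> range \<iota>"
    then obtain c where "z = \<iota> c" by blast
    then show "z \<in> B" unfolding B_def using q.closed(1) q'.closed(1) q.zero_nonunit q'.zero_nonunit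
      by (auto intro!: exI[of _ c])
  next
    fix a b assume "a \<in> B" "b \<in> B"
    then obtain c d where cd: "a - \<iota> c \<in> nonunits q" "a - \<iota> c \<in> nonunits q'"
      "b - \<iota> d \<in> nonunits q" "b - \<iota> d \<in> nonunits q'" and ab: "a \<in> q \<inter> q'" "b \<in> q \<inter> q'"
      unfolding B_def by blast
    have add: "a + b - \<iota> (c + d) = (a - \<iota> c) + (b - \<iota> d)" by (simp add: iota_add)
    have "a + b - \<iota> (c + d) \<in> nonunits q" "a + b - \<iota> (c + d) \<in> nonunits q'"
      unfolding add using cd by (blast intro: q.nonunit_add q'.nonunit_add)+
    then show "a + b \<in> B" unfolding B_def using ab q.closed(2) q'.closed(2) by blast
    have mult: "a * b - \<iota> (c * d) = b * (a - \<iota> c) + \<iota> c * (b - \<iota> d)"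
      by (simp add: iota_mult algebra_simps)
    have "a * b - \<iota> (c * d) \<in> nonunits q" "a * b - \<iota> (c * d) \<in> nonunits q'"
      unfolding mult using cd ab q.closed(1) q'.closed(1)
      by (blast intro: q.nonunit_add q.nonunit_mult q'.nonunit_add q'.nonunit_mult)+
    then show "a * b \<in> B" unfolding B_def using ab q.closed(3) q'.closed(3) by blast
  qed
  moreover have "S \<subseteq> B"
  proof
    fix s assume s: "s \<in> S"
    then have "s \<in> A" using A(2) by blast
    then have "s \<in> q" "s \<in> q'" using Aq by auto
    then show "s \<in> B" unfolding B_def using q.res_nonunit[of s] q'.res_nonunit[of s] eq[OF s] by auto
  qed
  ultimately have AB: "A \<subseteq> B" using generated_subset[OF A(2)] by blast
  have "a \<in> M \<longleftrightarrow> a \<in> M'" if aA: "a \<in> A" for a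
  proof -
    obtain c where c: "a - \<iota> c \<in> nonunits q" "a - \<iota> c \<in> nonunits q'" using AB aA by (auto simp: B_def)
    have "a \<in> nonunits q \<longleftrightarrow> c = 0" using q.residue_unique[OF c(1), of 0] c(1) by auto
    moreover have "a \<in> nonunits q' \<longleftrightarrow> c = 0" using q'.residue_unique[OF c(2), of 0] c(2) by auto
    ultimately show ?thesis using localization_nonunits[OF A(1)] M M' that by simp
  qed
  moreover have "M \<subseteq> A" "M' \<subseteq> A"
    using M M' ideal_closed(1) by (auto simp: is_maximal_ideal_def)
  ultimately have "M = M'" by blast
  then show ?thesis using M M' by simp
qed

text \<open>
  A pole of \<open>a / b\<close> is a zero of \<open>b\<close>. Each generator \<open>s\<close> of \<open>A\<close> satisfies \<open>P(s) \<in> b A\<close> for some \<open>P \<noteq> 0\<close>, so its residue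
  at a zero of \<open>b\<close> is one of the finitely many roots of \<open>P\<close>; and the residues of the generators determine the
  point.
\<close>

lemma finite_poles_affine:
  assumes A: "affine_model \<iota> A" and reg: "\<And>q. q \<in> affine_points A \<Longrightarrow> regular_dim_one q"
  shows "finite {q \<in> affine_points A. g \<notin> q}"
proof -
  have sub: "subalgebra \<iota> A" using A by (simp add: affine_model_def)
  obtain S where S: "finite S" "A = \<Inter>{B. subalgebra \<iota> B \<and> S \<subseteq> B}"
    using A by (auto simp: affine_model_def finitely_generated_def)
  obtain a b where ab: "a \<in> A" "b \<in> A" "b \<noteq> 0" "g = a / b"
    using A unfolding affine_model_def has_fraction_field_UNIV_def by blast
  have "\<forall>s. \<exists>P. P \<noteq> 0 \<and> (\<forall>B. subalgebra \<iota> B \<longrightarrow> s \<in> B \<longrightarrow> b \<in> B \<longrightarrow> (\<exists>r\<in>B. ev P s = b * r))"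
    using polynomial_multiple[OF ab(3)] by blast
  from choice[OF this] obtain P where P: "\<And>s. P s \<noteq> 0"
    "\<And>s B. subalgebra \<iota> B \<Longrightarrow> s \<in> B \<Longrightarrow> b \<in> B \<Longrightarrow> \<exists>r\<in>B. ev (P s) s = b * r" by blast
  have "\<forall>q\<in>affine_points A. \<exists>t. regular_point \<iota> q t" using affine_point_regular[OF A] reg by blast
  from bchoice[OF this] obtain t where t: "\<And>q. q \<in> affine_points A \<Longrightarrow> regular_point \<iota> q (t q)" by blast
  let ?res = "\<lambda>q. restrict (regular_point.res \<iota> q) S"
  have "?res q \<in> (\<Pi>\<^sub>E s\<in>S. {c. poly (P s) c = 0})" if q: "q \<in> affine_points A" "g \<notin> q" for q
  proof -
    interpret q: regular_point \<iota> q "t q" using t q by blast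
    obtain M where M: "is_maximal_ideal A M" "q = localization A M"
      using q by (auto simp: affine_points_def)
    have Aq: "A \<subseteq> q" using localization_subalgebra(2)[OF sub] M by auto
    have "b \<in> M" using q(2) ab M unfolding localization_def by blast
    then have b: "b \<in> nonunits q" using localization_nonunits[OF sub M(1)] ab M by simp
    have "poly (P s) (q.res s) = 0" if s: "s \<in> S" for s
    proof (rule q.res_root)
      have "s \<in> A" using s S(2) by blast
      then show sq: "s \<in> q" using Aq by blast
      obtain r where "r \<in> q" "ev (P s) s = b * r" using P(2)[OF q.subalg sq] ab Aq by blast
      then show "ev (P s) s \<in> nonunits q" using q.nonunit_mult[OF _ b, of r] by (simp add: mult.commute)
    qed
    then show ?thesis by auto
  qed
  then have "?res ` {q \<in> affine_points A. g \<notin> q} \<subseteq> (\<Pi>\<^sub>E s\<in>S. {c. poly (P s) c = 0})" by blast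
  moreover have "finite (\<Pi>\<^sub>E s\<in>S. {c. poly (P s) c = 0})"
    using S(1) P(1) by (intro finite_PiE) (auto simp: poly_roots_finite)
  ultimately have "finite (?res ` {q \<in> affine_points A. g \<notin> q})" by (rule finite_subset)
  moreover have "inj_on ?res {q \<in> affine_points A. g \<notin> q}"
  proof (rule inj_onI, clarify)
    fix q q' assume q: "q \<in> affine_points A" "q' \<in> affine_points A" and eq: "?res q = ?res q'"
    show "q = q'"
    proof (rule residues_inj[OF sub S(2) q(1) t[OF q(1)] q(2) t[OF q(2)]])
      fix s assume "s \<in> S"
      with fun_cong[OF eq, of s] show "regular_point.res \<iota> q s = regular_point.res \<iota> q' s" by simp
    qed
  qed
  ultimately show ?thesis by (rule finite_imageD)
qed

section \<open>Derivations of the function field\<close>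

lemma linear_derivation_iota:
  assumes "linear_derivation \<iota> D"
  shows "D (\<iota> c) = 0"
proof -
  have "D (1 * 1) = 1 * D 1 + 1 * D 1" using assms unfolding linear_derivation_def by blast
  then have "D 1 = 0" by (metis mult_1_left add_cancel_left_right)
  moreover have "D (\<iota> c * 1) = \<iota> c * D 1" using assms unfolding linear_derivation_def by blast
  ultimately show ?thesis by simp
qed

lemma linear_derivation_unique:
  assumes D: "linear_derivation \<iota> D" and E: "linear_derivation \<iota> E"
    and y: "y \<notin> range \<iota>" "D y = E y"
  shows "D = E"
proof
  fix g
  have "\<exists>r. D g - E g = id r * (D y - E y)"
  proof (rule derivation_multiple[where \<delta> = "\<lambda>g. D g - E g" and \<phi> = id])
    show "D (a + b) - E (a + b) = D a - E a + (D b - E b)" for a b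
      using D E by (simp add: linear_derivation_def)
    show "D (a * b) - E (a * b) = id a * (D b - E b) + id b * (D a - E a)" for a b
      using D E by (simp add: linear_derivation_def algebra_simps)
  qed (use y linear_derivation_iota[OF D] linear_derivation_iota[OF E] in auto)
  with y show "D g = E g" by simp
qed

text \<open>
  The chain rule \<open>dg/dt = (dy/dt) (dg/dy)\<close>.
\<close>

lemma linear_derivation_proportional:
  assumes D: "linear_derivation \<iota> D" and E: "linear_derivation \<iota> E"
    and y: "y \<notin> range \<iota>" "E y = 1"
  shows "D g = D y * E g"
proof -
  have "E (a + b) = E a + E b" "E (a * b) = a * E b + b * E a" for a b
    using E by (auto simp: linear_derivation_def)
  then have "linear_derivation \<iota> (\<lambda>g. D y * E g)"
    using linear_derivation_iota[OF E] by (simp add: linear_derivation_def algebra_simps)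
  from linear_derivation_unique[OF D this y(1)] y(2) have "D = (\<lambda>g. D y * E g)" by simp
  then show ?thesis by (rule fun_cong)
qed

text \<open>
  If \<open>D\<close> maps the finitely many generators of \<open>A\<close> into the local ring \<open>q\<close>, the product and quotient rules extend
  this to \<open>A\<close> and then to \<open>q\<close>. The exceptional points are therefore poles of the derivatives of the generators.
\<close>

lemma finite_derivation_poles_affine:
  assumes A: "affine_model \<iota> A" and reg: "\<And>q. q \<in> affine_points A \<Longrightarrow> regular_dim_one q"
    and D: "linear_derivation \<iota> D"
  shows "finite {q \<in> affine_points A. \<exists>g\<in>q. D g \<notin> q}"
proof -
  have sub: "subalgebra \<iota> A" using A by (simp add: affine_model_def)
  obtain S where S: "finite S" "A = \<Inter>{B. subalgebra \<iota> B \<and> S \<subseteq> B}"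
    using A by (auto simp: affine_model_def finitely_generated_def)
  have D_add: "D (a + b) = D a + D b" and D_mult: "D (a * b) = a * D b + b * D a" for a b
    using D by (auto simp: linear_derivation_def)
  have key: "D g \<in> q" if q: "q \<in> affine_points A" and Sq: "D ` S \<subseteq> q" and g: "g \<in> q" for q g
  proof -
    obtain M where M: "is_maximal_ideal A M" "q = localization A M"
      using q by (auto simp: affine_points_def)
    note q = localization_subalgebra[OF sub M(1), folded M(2)]
    note closed = subalgebra_closed[OF q(1)]
    define B where "B = {a\<in>q. D a \<in> q}"
    have "subalgebra \<iota> B"
      unfolding subalgebra_def
    proof (intro conjI ballI subsetI)
      show "z \<in> B" if "z \<in> range \<iota>" for z
        using that closed(1,7) linear_derivation_iota[OF D] by (auto simp: B_def)
      show "a + b \<in> B" "a * b \<in> B" if "a \<in> B" "b \<in> B" for a b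
        using that closed by (auto simp: B_def D_add D_mult)
    qed
    moreover have "S \<subseteq> B" using Sq S(2) q(2) by (auto simp: B_def)
    ultimately have DA: "D a \<in> q" if "a \<in> A" for a
      using generated_subset[OF S(2)] that unfolding B_def by blast
    obtain a b where ab: "a \<in> A" "b \<in> A - M" "g = a / b"
      using g unfolding M(2) localization_def by blast
    have "b \<notin> nonunits q" "b \<in> q" using localization_nonunits[OF sub M(1), of b] ab M(2) q(2) by auto
    then have b: "b \<noteq> 0" "inverse b \<in> q" by (auto simp: nonunits_def)
    have "a = b * g" using ab b by simp
    then have "D a = b * D g + g * D b" by (simp add: D_mult)
    then have Dg: "D g = inverse b * (D a - g * D b)" using b by simp
    have "D a \<in> q" "D b \<in> q" using DA[of a] DA[of b] ab(1,2) by auto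
    then show ?thesis unfolding Dg by (intro closed(3) closed(5) b g)
  qed
  have "{q \<in> affine_points A. \<exists>g\<in>q. D g \<notin> q} \<subseteq> (\<Union>s\<in>S. {q \<in> affine_points A. D s \<notin> q})"
    using key by (auto simp: image_subset_iff)
  moreover have "finite (\<Union>s\<in>S. {q \<in> affine_points A. D s \<notin> q})"
    using S(1) finite_poles_affine[OF A reg] by blast
  ultimately show ?thesis by (rule finite_subset)
qed

text \<open>
  With \<open>\<delta> g\<close> the derivative of the expansion of \<open>g\<close>, which is \<open>1\<close> at \<open>t\<close>, \<open>derivation_multiple\<close> shows
  that \<open>\<delta> g\<close> is again the expansion of an element of \<open>K\<close>; this element is the derivative of \<open>g\<close>.
\<close>

lemma expansion_derivation:
  assumes "expansion \<iota> q t \<phi>"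
  shows "linear_derivation \<iota> (deriv_wrt \<iota> t)" "deriv_wrt \<iota> t t = 1"
    "\<phi> (deriv_wrt \<iota> t g) = fls_deriv (\<phi> g)"
proof -
  interpret expansion \<iota> q t \<phi> by fact
  have "\<exists>r. fls_deriv (\<phi> g) = \<phi> r * fls_deriv (\<phi> t)" for g
    by (rule derivation_multiple[where \<phi> = \<phi> and \<delta> = "\<lambda>g. fls_deriv (\<phi> g)"])
      (use param_nonconstant in \<open>simp_all add: hom_add hom_mult hom_iota mult.commute\<close>)
  then have "\<forall>g. \<exists>r. \<phi> r = fls_deriv (\<phi> g)" by (metis hom_param fls_deriv_X mult.right_neutral)
  from choice[OF this] obtain D where D: "\<And>g. \<phi> (D g) = fls_deriv (\<phi> g)" by blast
  have lin: "linear_derivation \<iota> D"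
    unfolding linear_derivation_def
    by (intro conjI allI; rule hom_inj) (simp_all add: D hom_add hom_mult hom_iota algebra_simps)
  moreover have "D t = 1" by (rule hom_inj) (simp add: D hom_param)
  ultimately have "deriv_wrt \<iota> t = D"
    unfolding deriv_wrt_def using linear_derivation_unique param_nonconstant
    by (intro the_equality) auto
  then show "linear_derivation \<iota> (deriv_wrt \<iota> t)" "deriv_wrt \<iota> t t = 1"
    "\<phi> (deriv_wrt \<iota> t g) = fls_deriv (\<phi> g)"
    using lin \<open>D t = 1\<close> D by auto
qed

end

section \<open>Points of the curve\<close>

locale smooth_curve =
  fixes \<iota> :: "complex \<Rightarrow> 'k::field" and C :: "'k set set"
  assumes curve: "smooth_complete_curve \<iota> C"

sublocale smooth_curve \<subseteq> complex_function_field \<iota>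
  using curve by unfold_locales (auto simp: smooth_complete_curve_def)

context smooth_curve
begin

lemma models:
  obtains \<A> where "finite \<A>" "\<forall>A\<in>\<A>. affine_model \<iota> A" "C = (\<Union>A\<in>\<A>. affine_points A)"
proof -
  have "\<exists>\<A>. finite \<A> \<and> (\<forall>A\<in>\<A>. affine_model \<iota> A) \<and> C = (\<Union>A\<in>\<A>. affine_points A)"
    using curve unfolding smooth_complete_curve_def by (elim conjE)
  then show thesis using that by (elim exE conjE) simp
qed

lemma point_regular_dim_one: "q \<in> C \<Longrightarrow> regular_dim_one q"
  using curve unfolding smooth_complete_curve_def by (elim conjE) simp

lemma point_regular:
  assumes "q \<in> C"
  shows "\<exists>t. regular_point \<iota> q t"
proof -
  obtain \<A> where A: "finite \<A>" "\<forall>A\<in>\<A>. affine_model \<iota> A" "C = (\<Union>A\<in>\<A>. affine_points A)"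
    by (rule models)
  then obtain A where "A \<in> \<A>" "q \<in> affine_points A" using assms by blast
  with A show ?thesis using affine_point_regular point_regular_dim_one[OF assms] by blast
qed

lemma point_expansion:
  assumes "q \<in> C" "local_parameter q s"
  obtains \<phi> where "expansion \<iota> q s \<phi>"
proof -
  obtain t where "regular_point \<iota> q t" using point_regular[OF assms(1)] by blast
  from regular_point.local_parameter_expansion[OF this assms(2) that] show thesis .
qed

lemma finite_poles: "finite {q\<in>C. g \<notin> q}"
proof -
  obtain \<A> where A: "finite \<A>" "\<forall>A\<in>\<A>. affine_model \<iota> A" "C = (\<Union>A\<in>\<A>. affine_points A)"
    by (rule models)
  have "finite (\<Union>A\<in>\<A>. {q\<in>affine_points A. g \<notin> q})"
    using A point_regular_dim_one by (intro finite_UN_I finite_poles_affine) auto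
  moreover have "{q\<in>C. g \<notin> q} = (\<Union>A\<in>\<A>. {q\<in>affine_points A. g \<notin> q})" using A(3) by blast
  ultimately show ?thesis by simp
qed

lemma finite_derivation_poles:
  assumes "linear_derivation \<iota> D"
  shows "finite {q\<in>C. \<exists>g\<in>q. D g \<notin> q}"
proof -
  obtain \<A> where A: "finite \<A>" "\<forall>A\<in>\<A>. affine_model \<iota> A" "C = (\<Union>A\<in>\<A>. affine_points A)"
    by (rule models)
  have "finite (\<Union>A\<in>\<A>. {q\<in>affine_points A. \<exists>g\<in>q. D g \<notin> q})"
    using A point_regular_dim_one assms by (intro finite_UN_I finite_derivation_poles_affine) auto
  moreover have "{q\<in>C. \<exists>g\<in>q. D g \<notin> q} = (\<Union>A\<in>\<A>. {q\<in>affine_points A. \<exists>g\<in>q. D g \<notin> q})"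
    using A(3) by blast
  ultimately show ?thesis by simp
qed

end

section \<open>Valuation rings and the existence of poles\<close>

context complex_field_extension
begin

text \<open>
  One step of the descent that shows that \<open>h\<close> and \<open>1/h\<close> cannot both lie outside a maximal subalgebra in which
  \<open>s\<close> is not a unit. The hypotheses on \<open>P\<close> and \<open>Q\<close> say that \<open>s\<close> becomes a unit on adjoining \<open>h\<close>
  and on adjoining \<open>1/h\<close>. The second relation, divided by the unit \<open>1 - s b\<^sub>0\<close>, where \<open>b\<^sub>0\<close> is the
  constant coefficient of \<open>Q\<close>, and multiplied by \<open>h ^ n\<close>, writes \<open>h ^ n\<close> as a polynomial \<open>R\<close> in \<open>h\<close> of degree less than \<open>n = degree P\<close>, which removes the leading
  term of \<open>P\<close>.
\<close>

lemma reduce_degree: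
  assumes V: "subalgebra \<iota> V" and s: "s \<in> V"
    and units: "\<And>b. b \<in> V \<Longrightarrow> 1 - s * b \<noteq> 0 \<and> inverse (1 - s * b) \<in> V"
    and h: "h \<noteq> 0"
    and P: "\<And>i. coeff P i \<in> V" "s * poly P h = 1"
    and Q: "\<And>i. coeff Q i \<in> V" "s * poly Q (inverse h) = 1"
    and deg: "degree Q \<le> degree P"
  shows "\<exists>P'. (\<forall>i. coeff P' i \<in> V) \<and> s * poly P' h = 1 \<and> degree P' < degree P"
proof -
  note closed = subalgebra_closed[OF V]
  define n where "n = degree P"
  define m where "m = degree Q"
  define w where "w = inverse (1 - s * coeff Q 0)"
  have w: "w \<in> V" "w * (1 - s * coeff Q 0) = 1" using units[OF Q(1)] by (auto simp: w_def)
  have "n > 0"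
  proof (rule ccontr)
    assume "\<not> n > 0"
    then obtain a where "P = [:a:]" using n_def by (metis degree_eq_zeroE gr0I)
    then have "a \<in> V" "s * a = 1" using P(1)[of 0] P(2) by auto
    with units[of a] show False by simp
  qed
  have "1 - s * coeff Q 0 = s * (\<Sum>j=1..m. coeff Q j * inverse h ^ j)"
    using Q(2) unfolding poly_altdef m_def
    by (simp add: atLeast0AtMost[symmetric] sum.atLeast_Suc_atMost algebra_simps)
  then have one: "1 = w * (s * (\<Sum>j=1..m. coeff Q j * inverse h ^ j))" using w(2) by simp
  define R where "R = (\<Sum>j=1..m. monom (w * s * coeff Q j) (n - j))"
  have R_coeff: "coeff R i \<in> V" for i
    unfolding R_def coeff_sum using w s Q(1) closed(3,7)
    by (intro subalgebra_sum[OF V]) auto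
  have R_deg: "degree R \<le> n - 1"
    unfolding R_def by (intro degree_sum_le) (auto intro!: order_trans[OF degree_monom_le])
  have R_poly: "poly R h = h ^ n"
  proof -
    have "h ^ n * 1 = h ^ n * (w * (s * (\<Sum>j=1..m. coeff Q j * inverse h ^ j)))"
      by (simp only: one[symmetric])
    also have "\<dots> = (\<Sum>j=1..m. w * s * coeff Q j * (h ^ n * inverse h ^ j))"
      by (simp add: sum_distrib_left mult_ac)
    also have "\<dots> = poly R h"
      unfolding R_def poly_sum poly_monom
    proof (intro sum.cong refl)
      fix j assume "j \<in> {1..m}"
      then have "j \<le> n" using deg by (simp add: n_def m_def)
      then show "w * s * coeff Q j * (h ^ n * inverse h ^ j) = w * s * coeff Q j * h ^ (n - j)"
        using h by (simp add: power_diff power_inverse divide_inverse)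
    qed
    finally show ?thesis by simp
  qed
  define P' where "P' = P - monom (coeff P n) n + smult (coeff P n) R"
  have "coeff P' i \<in> V" for i
    unfolding P'_def using P(1) R_coeff closed by (cases "i = n") auto
  moreover have "poly P' h = poly P h" by (simp add: P'_def R_poly poly_monom)
  moreover have "degree P' < n"
  proof -
    have "degree (P - monom (coeff P n) n) \<le> n - 1"
    proof (rule degree_le, intro allI impI)
      fix i assume "n - 1 < i"
      then have "i = n \<or> n < i" by linarith
      then show "coeff (P - monom (coeff P n) n) i = 0" by (auto simp: n_def coeff_eq_0)
    qed
    moreover have "degree (smult (coeff P n) R) \<le> n - 1"
      using degree_smult_le[of "coeff P n" R] R_deg by linarith
    ultimately have "degree P' \<le> n - 1" unfolding P'_def by (intro degree_add_le)
    with \<open>n > 0\<close> show ?thesis by simp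
  qed
  ultimately show ?thesis using P(2) by (intro exI[of _ P']) (auto simp: n_def)
qed

definition adjoin :: "'k set \<Rightarrow> 'k \<Rightarrow> 'k set" where
  "adjoin V h = {poly P h | P. \<forall>i. coeff P i \<in> V}"

lemma adjoin_subalgebra:
  assumes V: "subalgebra \<iota> V"
  shows "subalgebra \<iota> (adjoin V h)" "V \<subseteq> adjoin V h" "h \<in> adjoin V h"
proof -
  note closed = subalgebra_closed[OF V]
  show sub: "V \<subseteq> adjoin V h"
  proof
    fix a assume "a \<in> V"
    then show "a \<in> adjoin V h" unfolding adjoin_def using closed(7)
      by (intro CollectI exI[of _ "[:a:]"]) (auto simp: coeff_pCons split: nat.splits)
  qed
  show "h \<in> adjoin V h" unfolding adjoin_def using closed(6,7)
    by (intro CollectI exI[of _ "[:0, 1:]"]) (auto simp: coeff_pCons split: nat.splits)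
  show "subalgebra \<iota> (adjoin V h)"
    unfolding subalgebra_def
  proof (intro conjI ballI)
    show "range \<iota> \<subseteq> adjoin V h" using sub closed(1) by blast
    fix a b assume "a \<in> adjoin V h" "b \<in> adjoin V h"
    then obtain P Q where P: "\<forall>i. coeff P i \<in> V" "a = poly P h" and Q: "\<forall>i. coeff Q i \<in> V" "b = poly Q h"
      unfolding adjoin_def by blast
    show "a + b \<in> adjoin V h" unfolding adjoin_def using P Q closed(2)
      by (intro CollectI exI[of _ "P + Q"]) auto
    have "coeff (P * Q) i \<in> V" for i
      unfolding coeff_mult using P Q closed(3) by (intro subalgebra_sum[OF V]) auto
    then show "a * b \<in> adjoin V h" unfolding adjoin_def using P Q
      by (intro CollectI exI[of _ "P * Q"]) auto
  qed
qed

text \<open>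
  By Zorn's lemma there is a subalgebra \<open>V\<close> that is maximal among those containing \<open>s\<close> but not its inverse. By
  maximality \<open>s\<close> becomes a unit as soon as an element outside \<open>V\<close> is adjoined. It follows that every \<open>1 - s b\<close>
  is a unit of \<open>V\<close>, and the descent of \<open>reduce_degree\<close> shows that \<open>V\<close> is a valuation ring.
\<close>

lemma valuation_ring_exists:
  assumes s: "s \<notin> range \<iota>"
  shows "\<exists>V. valuation_ring \<iota> V \<and> inverse s \<notin> V"
proof -
  have "s \<noteq> 0" using s iota_0 by (metis rangeI)
  define \<S> where "\<S> = {B. subalgebra \<iota> B \<and> s \<in> B \<and> inverse s \<notin> B}"
  have "\<exists>V\<in>\<S>. \<forall>B\<in>\<S>. V \<subseteq> B \<longrightarrow> B = V"
  proof (rule subset_Zorn_nonempty)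
    define B where "B = {ev P s | P. True}"
    have "subalgebra \<iota> B"
      unfolding subalgebra_def
    proof (intro conjI ballI subsetI)
      fix z assume "z \<in> range \<iota>"
      then obtain c where "z = ev [:c:] s" by auto
      then show "z \<in> B" unfolding B_def by blast
    next
      fix a b assume "a \<in> B" "b \<in> B"
      then obtain P Q where "a = ev P s" "b = ev Q s" unfolding B_def by blast
      then have "a + b = ev (P + Q) s" "a * b = ev (P * Q) s" by (simp_all add: ev_add ev_mult)
      then show "a + b \<in> B" "a * b \<in> B" unfolding B_def by blast+
    qed
    moreover have "s = ev [:0, 1:] s" by simp
    then have "s \<in> B" unfolding B_def by blast
    moreover have "inverse s \<notin> B"
    proof
      assume "inverse s \<in> B"
      then obtain P where "inverse s = ev P s" unfolding B_def by blast
      then have "ev (pCons (- 1) P) s = 0" using \<open>s \<noteq> 0\<close> by (simp add: iota_minus flip: \<open>inverse s = ev P s\<close>)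
      then show False using nonconstant_ev_nonzero[OF s, of "pCons (- 1) P"] by simp
    qed
    ultimately show "\<S> \<noteq> {}" unfolding \<S>_def by blast
  next
    fix \<C> assume ne: "\<C> \<noteq> {}" and chain: "subset.chain \<S> \<C>"
    have mem: "subalgebra \<iota> B" "s \<in> B" "inverse s \<notin> B" if "B \<in> \<C>" for B
      using that chain by (auto simp: subset.chain_def \<S>_def)
    have "subalgebra \<iota> (\<Union>\<C>)"
      unfolding subalgebra_def
    proof (intro conjI ballI)
      show "range \<iota> \<subseteq> \<Union>\<C>" using ne mem(1) iota_mem by blast
      fix a b assume "a \<in> \<Union>\<C>" "b \<in> \<Union>\<C>"
      then obtain B B' where B: "B \<in> \<C>" "B' \<in> \<C>" "a \<in> B" "b \<in> B'" by blast
      then have "B \<subseteq> B' \<or> B' \<subseteq> B" using chain by (auto simp: subset.chain_def)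
      then obtain B'' where "B'' \<in> \<C>" "a \<in> B''" "b \<in> B''" using B by blast
      then show "a + b \<in> \<Union>\<C>" "a * b \<in> \<Union>\<C>"
        using subalgebra_add[OF mem(1)] subalgebra_mult[OF mem(1)] by blast+
    qed
    then show "\<Union>\<C> \<in> \<S>" unfolding \<S>_def using ne mem by blast
  qed
  then obtain V where V: "V \<in> \<S>" and max: "\<And>B. B \<in> \<S> \<Longrightarrow> V \<subseteq> B \<Longrightarrow> B = V" by blast
  have sub: "subalgebra \<iota> V" and sV: "s \<in> V" and inv: "inverse s \<notin> V" using V by (auto simp: \<S>_def)
  note closed = subalgebra_closed[OF sub]
  have adj: "\<exists>P. (\<forall>i. coeff P i \<in> V) \<and> s * poly P h = 1" if "h \<notin> V" for h
  proof -
    have "adjoin V h \<noteq> V" using adjoin_subalgebra(3)[OF sub, of h] that by blast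
    then have "adjoin V h \<notin> \<S>" using max adjoin_subalgebra(2)[OF sub] by blast
    then have "inverse s \<in> adjoin V h"
      using adjoin_subalgebra[OF sub, of h] sV unfolding \<S>_def by blast
    then obtain P where P: "\<forall>i. coeff P i \<in> V" "inverse s = poly P h" unfolding adjoin_def by blast
    then show ?thesis using \<open>s \<noteq> 0\<close> by (intro exI[of _ P]) (simp flip: P(2))
  qed
  have units: "1 - s * b \<noteq> 0 \<and> inverse (1 - s * b) \<in> V" if b: "b \<in> V" for b
  proof
    show nz: "1 - s * b \<noteq> 0"
    proof
      assume "1 - s * b = 0"
      then have "inverse s = b" by (simp add: inverse_unique)
      with b inv show False by simp
    qed
    show "inverse (1 - s * b) \<in> V"
    proof (rule ccontr)
      assume "inverse (1 - s * b) \<notin> V"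
      from adj[OF this] obtain P where P: "\<And>i. coeff P i \<in> V" "s * poly P (inverse (1 - s * b)) = 1"
        by blast
      define u where "u = 1 - s * b"
      define n where "n = degree P"
      have u: "u \<in> V" "u \<noteq> 0" using b sV closed nz by (auto simp: u_def)
      \<comment> \<open>The relation from \<open>adj\<close>, multiplied by \<open>u ^ n\<close>, gives \<open>u ^ n / s \<in> V\<close>; but \<open>u ^ n\<close> is \<open>1\<close> modulo \<open>s\<close>.\<close>
      have "\<exists>c\<in>V. u ^ k = 1 - s * c" for k
      proof (induction k)
        case 0
        then show ?case using closed(7) by (intro bexI[of _ 0]) auto
      next
        case (Suc k)
        then obtain c where "c \<in> V" "u ^ k = 1 - s * c" by blast
        then have "u ^ Suc k = u * (1 - s * c)" by simp
        also have "\<dots> = 1 - s * (b + c - s * b * c)" by (simp add: u_def algebra_simps)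
        finally show ?case using b sV \<open>c \<in> V\<close> closed(2,3,5)
          by (intro bexI[of _ "b + c - s * b * c"]) simp_all
      qed
      then obtain c where c: "c \<in> V" "u ^ n = 1 - s * c" by blast
      have "u ^ n * poly P (inverse u) = (\<Sum>i\<le>n. coeff P i * u ^ (n - i))"
        unfolding poly_altdef n_def[symmetric] sum_distrib_left
        by (intro sum.cong) (auto simp: power_diff u power_inverse divide_inverse mult_ac)
      then have mem: "u ^ n * poly P (inverse u) \<in> V"
        using P(1) u closed by (auto intro!: subalgebra_sum[OF sub])
      have "poly P (inverse u) = inverse s"
        using P(2) by (metis u_def inverse_unique)
      then have "u ^ n * poly P (inverse u) = inverse s - c"
        using \<open>s \<noteq> 0\<close> by (simp add: c(2) left_diff_distrib)
      then have "inverse s = u ^ n * poly P (inverse u) + c" by simp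
      then have "inverse s \<in> V" using mem c(1) closed(2) by metis
      with inv show False by simp
    qed
  qed
  have "h \<in> V \<or> inverse h \<in> V" for h
  proof (rule ccontr)
    assume no: "\<not> (h \<in> V \<or> inverse h \<in> V)"
    then have "h \<noteq> 0" using closed(7) by auto
    define good where "good = (\<lambda>h P. (\<forall>i. coeff P i \<in> V) \<and> s * poly P h = 1)"
    obtain P0 where "good h P0" using adj no unfolding good_def by blast
    from ex_has_least_nat[of "good h", OF this, of degree]
    obtain P where P: "good h P" "\<And>P'. good h P' \<Longrightarrow> degree P \<le> degree P'" by blast
    obtain Q0 where "good (inverse h) Q0" using adj no unfolding good_def by blast
    from ex_has_least_nat[of "good (inverse h)", OF this, of degree]
    obtain Q where Q: "good (inverse h) Q" "\<And>Q'. good (inverse h) Q' \<Longrightarrow> degree Q \<le> degree Q'" by blast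
    consider "degree Q \<le> degree P" | "degree P \<le> degree Q" by linarith
    then show False
    proof cases
      case 1
      have "\<exists>P'. (\<forall>i. coeff P' i \<in> V) \<and> s * poly P' h = 1 \<and> degree P' < degree P"
        using P(1) Q(1) \<open>h \<noteq> 0\<close> 1 unfolding good_def
        by (intro reduce_degree[OF sub sV units, of h P Q]) auto
      then show False using P(2) unfolding good_def by (meson not_le)
    next
      case 2
      have "\<exists>Q'. (\<forall>i. coeff Q' i \<in> V) \<and> s * poly Q' (inverse h) = 1 \<and> degree Q' < degree Q"
        using P(1) Q(1) \<open>h \<noteq> 0\<close> 2 unfolding good_def
        by (intro reduce_degree[OF sub sV units, of "inverse h" Q P]) auto
      then show False using Q(2) unfolding good_def by (meson not_le)
    qed
  qed
  then have "valuation_ring \<iota> V" using sub by (simp add: valuation_ring_def)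
  with inv show ?thesis by blast
qed

end

context smooth_curve
begin

lemma nonconstant_has_pole:
  assumes "g \<notin> range \<iota>"
  shows "\<exists>q\<in>C. g \<notin> q"
proof -
  have "inverse g \<notin> range \<iota>"
  proof
    assume "inverse g \<in> range \<iota>"
    then obtain c where "inverse g = \<iota> c" by blast
    then have "g = \<iota> (inverse c)" using iota_inverse[of c] by (metis inverse_inverse_eq)
    with assms show False by blast
  qed
  from valuation_ring_exists[OF this] obtain V where V: "valuation_ring \<iota> V" "g \<notin> V" by auto
  have "\<forall>V. valuation_ring \<iota> V \<longrightarrow> V \<noteq> UNIV \<longrightarrow> (\<exists>!q. q \<in> C \<and> dominates V q)"
    using curve unfolding smooth_complete_curve_def by (elim conjE)
  with V obtain q where "q \<in> C" "dominates V q" by blast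
  with V show ?thesis by (auto simp: dominates_def)
qed

lemma point_mem_iff:
  assumes "q \<in> C"
  shows "g \<in> q \<longleftrightarrow> 0 \<le> val_at q g"
proof -
  obtain t where "regular_point \<iota> q t" using point_regular[OF assms] by blast
  then interpret regular_point \<iota> q t .
  show ?thesis by (simp add: val_at_expand expand_mem_iff)
qed

section \<open>Zeros and poles\<close>

text \<open>
  The functions \<open>u s = g ^ (s div n) * x ^ (s mod n)\<close> have order exactly \<open>s\<close> at \<open>p\<close>, where \<open>n\<close> is the order of \<open>g\<close>.
  There are \<open>n * (k + 1) - 1\<close> of them with \<open>1 \<le> s < n * (k + 1)\<close>, and their principal parts have
  at most \<open>k * H + n * H'\<close> coefficients, \<open>H\<close> and \<open>H'\<close> being the numbers of poles of \<open>g\<close> and \<open>x\<close>. If \<open>H < n\<close>,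
  a suitable \<open>k\<close> makes the former number larger, and a nontrivial combination without poles exists. Its
  order at \<open>p\<close> is positive and finite, so it is not constant.
\<close>

lemma order_le_poles:
  assumes p: "expansion \<iota> p x \<phi>" and g: "val_at p g > 0"
  shows "val_at p g \<le> (\<Sum>q\<in>{q\<in>C. val_at q g < 0}. - val_at q g)"
proof (rule ccontr)
  assume "\<not> val_at p g \<le> (\<Sum>q\<in>{q\<in>C. val_at q g < 0}. - val_at q g)"
  then have less: "(\<Sum>q\<in>{q\<in>C. val_at q g < 0}. - val_at q g) < val_at p g" by simp
  interpret p: expansion \<iota> p x \<phi> by fact
  have nz: "g \<noteq> 0" "x \<noteq> 0" using g p.val_eq[of g] p.hom_param by auto
  have "\<exists>t \<psi>. expansion \<iota> q t \<psi>" if "q \<in> C" for q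
    using point_regular[OF that] regular_point.expansion_expand by blast
  then have "\<forall>q\<in>C. \<exists>\<psi>. \<exists>t. expansion \<iota> q t \<psi>" by blast
  from bchoice[OF this] obtain \<psi> where \<psi>: "\<And>q. q \<in> C \<Longrightarrow> \<exists>t. expansion \<iota> q t (\<psi> q)" by blast
  define n where "n = nat (val_at p g)"
  have n: "n > 0" "int n = val_at p g" using g by (auto simp: n_def)
  define e where "e = (\<lambda>q. nat (- val_at q g))"
  define e' where "e' = (\<lambda>q. nat (- val_at q x))"
  define Q where "Q = {q\<in>C. g \<notin> q} \<union> {q\<in>C. x \<notin> q}"
  have "finite Q" by (simp add: Q_def finite_poles)
  define H where "H = (\<Sum>q\<in>Q. e q)"
  define H' where "H' = (\<Sum>q\<in>Q. e' q)"
  have "int H = (\<Sum>q\<in>Q. if val_at q g < 0 then - val_at q g else 0)"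
    unfolding H_def of_nat_sum by (intro sum.cong) (auto simp: e_def)
  also have "\<dots> = (\<Sum>q\<in>{q\<in>C. val_at q g < 0}. - val_at q g)"
    unfolding sum.inter_filter[OF \<open>finite Q\<close>, symmetric]
    by (intro sum.cong) (auto simp: Q_def point_mem_iff)
  finally have "H < n" using less n by linarith
  \<comment> \<open>Any \<open>k\<close> with \<open>n * H' < k + n - 1\<close> will do, because \<open>k * H + k \<le> k * n\<close>.\<close>
  define k where "k = n * H' + 1"
  \<comment> \<open>Starting at \<open>1\<close> leaves out the constant function.\<close>
  define I where "I = {1..<n * (k + 1)}"
  define J where "J = (SIGMA q:Q. {1..k * e q + n * e' q})"
  define u where "u = (\<lambda>s. g ^ (s div n) * x ^ (s mod n))"
  have "card J < card I"
  proof -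
    have "card J = (\<Sum>q\<in>Q. k * e q + n * e' q)"
      unfolding J_def using \<open>finite Q\<close> by (subst card_SigmaI) auto
    also have "\<dots> = k * H + n * H'" by (simp add: H_def H'_def sum.distrib sum_distrib_left)
    also have "\<dots> < k * H + k + n - 1" using n by (simp add: k_def)
    also have "\<dots> \<le> k * n + n - 1"
    proof -
      have "k * Suc H \<le> k * n" using \<open>H < n\<close> by (intro mult_le_mono2) simp
      then show ?thesis by simp
    qed
    also have "\<dots> = card I" by (simp add: I_def algebra_simps)
    finally show ?thesis .
  qed
  moreover have "finite I" "finite J" using \<open>finite Q\<close> by (auto simp: I_def J_def)
  ultimately obtain l where l: "\<exists>s\<in>I. l s \<noteq> 0"
      "\<forall>qm\<in>J. (\<Sum>s\<in>I. l s * \<psi> (fst qm) (u s) $$ (- int (snd qm))) = 0"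
    using underdetermined_system[of J I "\<lambda>s qm. \<psi> (fst qm) (u s) $$ (- int (snd qm))"] by blast
  define v where "v = (\<Sum>s\<in>I. \<iota> (l s) * u s)"
  have v_nth: "\<chi> v $$ i = (\<Sum>s\<in>I. l s * \<chi> (u s) $$ i)" if "expansion \<iota> q t \<chi>" for q t \<chi> i
  proof -
    interpret expansion \<iota> q t \<chi> by fact
    show ?thesis by (simp add: v_def hom_sum hom_mult hom_iota fls_nth_sum)
  qed
  have u_sub: "fls_subdegree (\<chi> (u s)) = int (s div n) * val_at q g + int (s mod n) * val_at q x"
    if "expansion \<iota> q t \<chi>" for q t \<chi> s
  proof -
    interpret expansion \<iota> q t \<chi> by fact
    show ?thesis using nz by (simp add: u_def hom_mult hom_power fls_subdegree_pow val_eq)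
  qed
  have "v \<in> q" if q: "q \<in> C" for q
  proof -
    obtain t where t: "expansion \<iota> q t (\<psi> q)" using \<psi>[OF q] by blast
    interpret expansion \<iota> q t "\<psi> q" by fact
    have "\<psi> q v $$ i = 0" if "i < 0" for i
    proof -
      define m where "m = nat (- i)"
      have m: "1 \<le> m" "i = - int m" using that by (auto simp: m_def)
      show ?thesis
      proof (cases "m \<le> k * e q + n * e' q")
        case True
        then have "e q > 0 \<or> e' q > 0" using m by (cases "e q"; cases "e' q") auto
        then have "q \<in> Q" using q by (auto simp: Q_def e_def e'_def point_mem_iff)
        then have "(q, m) \<in> J" using True m by (simp add: J_def)
        with l(2) show ?thesis by (auto simp: v_nth[OF t] m)
      next
        case False
        have "\<psi> q (u s) $$ i = 0" if s: "s \<in> I" for s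
        proof -
          have "s div n \<le> k" using s n
            by (simp add: I_def less_mult_imp_div_less mult.commute less_Suc_eq_le[symmetric])
          then have "int (s div n) * int (e q) \<le> int k * int (e q)"
            by (intro mult_right_mono) auto
          moreover have "int (s div n) * (- val_at q g) \<le> int (s div n) * int (e q)"
            by (intro mult_left_mono) (auto simp: e_def)
          moreover have "int (s mod n) * int (e' q) \<le> int n * int (e' q)"
            using mod_less_divisor[OF n(1), of s] by (intro mult_right_mono) simp_all
          moreover have "int (s mod n) * (- val_at q x) \<le> int (s mod n) * int (e' q)"
            by (intro mult_left_mono) (auto simp: e'_def)
          moreover have "int k * int (e q) + int n * int (e' q) < int m"
            using False by (simp flip: of_nat_mult of_nat_add)
          ultimately have "i < fls_subdegree (\<psi> q (u s))" unfolding u_sub[OF t] m by simp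
          then show ?thesis by simp
        qed
        then show ?thesis by (simp add: v_nth[OF t])
      qed
    qed
    then show ?thesis unfolding mem_iff by (rule fls_subdegree_ge0I)
  qed
  then obtain c where c: "v = \<iota> c" using nonconstant_has_pole[of v] by blast
  define s0 where "s0 = Min {s\<in>I. l s \<noteq> 0}"
  have "finite {s\<in>I. l s \<noteq> 0}" "{s\<in>I. l s \<noteq> 0} \<noteq> {}" using l(1) \<open>finite I\<close> by auto
  then have s0: "s0 \<in> I" "l s0 \<noteq> 0" and min: "\<And>s. s \<in> I \<Longrightarrow> s < s0 \<Longrightarrow> l s = 0"
    using Min_in[of "{s\<in>I. l s \<noteq> 0}"] Min_le[of "{s\<in>I. l s \<noteq> 0}"] unfolding s0_def by force+
  have sub: "fls_subdegree (\<phi> (u s)) = int s" for s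
  proof -
    have "val_at p x = 1" using p.val_eq[of x] p.hom_param by simp
    then have "fls_subdegree (\<phi> (u s)) = int (s div n * n + s mod n)"
      unfolding u_sub[OF p] n(2)[symmetric] by (simp only: of_nat_add of_nat_mult mult_1_right)
    then show ?thesis by (simp only: div_mult_mod_eq)
  qed
  have "\<phi> v $$ int s0 = (\<Sum>s\<in>I. if s = s0 then l s0 * \<phi> (u s0) $$ int s0 else 0)"
    unfolding v_nth[OF p]
  proof (intro sum.cong refl)
    fix s assume "s \<in> I"
    then consider "s < s0" "l s = 0" | "s = s0" | "s > s0" using min by (metis linorder_neqE_nat)
    then show "l s * \<phi> (u s) $$ int s0 = (if s = s0 then l s0 * \<phi> (u s0) $$ int s0 else 0)"
      by cases (auto simp: sub)
  qed
  also have "\<dots> = l s0 * \<phi> (u s0) $$ int s0" using s0 \<open>finite I\<close> by simp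
  also have "\<dots> \<noteq> 0"
  proof -
    have "\<phi> (u s0) \<noteq> 0" using nz by (simp add: u_def)
    from nth_fls_subdegree_nonzero[OF this] s0(2) show ?thesis by (simp add: sub)
  qed
  finally show False using s0(1) by (simp add: c p.hom_iota I_def)
qed

end

section \<open>The bound on the exponents\<close>

context expansion
begin

lemma nth_of_sums:
  fixes a :: "nat \<Rightarrow> int"
  assumes sums: "sums_at q (\<lambda>n. \<iota> (\<alpha> n) * t powi a n) f"
    and a: "strict_mono a" "a 0 = 0"
  shows "\<phi> f $$ a k = \<alpha> k" and "m \<notin> range a \<Longrightarrow> \<phi> f $$ m = 0"
proof -
  have a_nn: "a n \<ge> 0" for n using a strict_mono_less_eq[OF a(1), of 0 n] by simp
  have pow: "\<phi> (t powi a n) $$ m = (if m = a n then 1 else 0)" for n m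
    using a_nn[of n] by (simp add: power_int_def hom_power hom_param)
  have ev: "\<forall>\<^sub>F N in sequentially. \<phi> f $$ m = (\<Sum>n<N. if m = a n then \<alpha> n else 0)" for m
  proof -
    have "\<forall>\<^sub>F N in sequentially. f - (\<Sum>n<N. \<iota> (\<alpha> n) * t powi a n) = 0 \<or>
        m + 1 \<le> val_at q (f - (\<Sum>n<N. \<iota> (\<alpha> n) * t powi a n))"
      using sums unfolding sums_at_def by blast
    then show ?thesis
    proof (rule eventually_mono)
      fix N
      let ?r = "f - (\<Sum>n<N. \<iota> (\<alpha> n) * t powi a n)"
      assume "?r = 0 \<or> m + 1 \<le> val_at q ?r"
      then have "\<phi> ?r $$ m = 0" by (auto simp: val_eq simp del: hom_diff)
      then have "\<phi> f $$ m = (\<Sum>n<N. \<alpha> n * \<phi> (t powi a n) $$ m)"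
        by (simp add: hom_diff hom_sum hom_mult hom_iota fls_nth_sum)
      also have "\<dots> = (\<Sum>n<N. if m = a n then \<alpha> n else 0)"
        by (intro sum.cong) (auto simp: pow)
      finally show "\<phi> f $$ m = (\<Sum>n<N. if m = a n then \<alpha> n else 0)" .
    qed
  qed
  show "\<phi> f $$ a k = \<alpha> k"
  proof -
    obtain N where N: "\<And>N'. N' \<ge> N \<Longrightarrow> \<phi> f $$ a k = (\<Sum>n<N'. if a k = a n then \<alpha> n else 0)"
      using ev[of "a k"] unfolding eventually_sequentially by blast
    have "(a k = a n) = (k = n)" for n using strict_mono_eq[OF a(1)] .
    with N[of "max N (Suc k)"] show ?thesis by simp
  qed
  show "\<phi> f $$ m = 0" if "m \<notin> range a"
  proof -
    obtain N where N: "\<phi> f $$ m = (\<Sum>n<N. if m = a n then \<alpha> n else 0)"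
      using ev[of m] unfolding eventually_sequentially by blast
    also have "\<dots> = 0" using that by (intro sum.neutral) auto
    finally show ?thesis .
  qed
qed

end

text \<open>
  The bound \<open>B\<close> is nonpositive here and below because the zero series has subdegree \<open>0\<close>.
\<close>

lemma fls_subdegree_diff_ge:
  fixes F G :: "'a::ab_group_add fls"
  assumes "B \<le> 0" "B \<le> fls_subdegree F" "B \<le> fls_subdegree G"
  shows "B \<le> fls_subdegree (F - G)"
proof (cases "F - G = 0")
  case False
  then show ?thesis using assms by (intro fls_subdegree_geI) auto
qed (use assms in simp)

lemma fls_subdegree_const_mult_ge:
  fixes F :: "'a::idom fls"
  assumes "B \<le> 0" "B \<le> fls_subdegree F"
  shows "B \<le> fls_subdegree (fls_const c * F)"
proof (cases "fls_const c * F = 0")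
  case False
  then show ?thesis using assms by (intro fls_subdegree_geI) auto
qed (use assms in auto)

context complex_function_field
begin

text \<open>
  The order at \<open>q\<close> of \<open>x dg/dx\<close> is \<open>v(x) + v(dg/dt) - e\<close> with \<open>e = v(dx/dt)\<close>. If \<open>v(x) \<noteq> 0\<close>,
  then \<open>e = v(x) - 1\<close> cancels the loss of one in \<open>v(dg/dt) \<ge> v(g) - 1\<close>. If \<open>v(x) = 0\<close>, the loss is at most \<open>e + 1\<close>, and a function without a pole loses only \<open>e\<close>.
  The lower bound \<open>B\<close> rather than \<open>val_at q g\<close> itself makes the estimates easy to iterate.
\<close>

lemma euler_pole_bound:
  assumes q: "expansion \<iota> q t \<psi>" and D: "linear_derivation \<iota> D" "D x = 1" and x: "x \<notin> range \<iota>"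
    and B: "B \<le> 0" "B \<le> val_at q g"
  defines "e \<equiv> val_at q (deriv_wrt \<iota> t x)"
  shows "val_at q x \<noteq> 0 \<Longrightarrow> B \<le> val_at q (x * D g)"
    and "val_at q x = 0 \<Longrightarrow> B - (e + 1) \<le> val_at q (x * D g)"
    and "val_at q x = 0 \<Longrightarrow> e = 0 \<Longrightarrow> B = 0 \<Longrightarrow> 0 \<le> val_at q (x * D g)"
    and "val_at q x = 0 \<Longrightarrow> 0 \<le> e"
    and "D t * deriv_wrt \<iota> t x = 1"
proof -
  interpret expansion \<iota> q t \<psi> by fact
  note der = expansion_derivation[OF q]
  have chain: "deriv_wrt \<iota> t h = deriv_wrt \<iota> t x * D h" for h
    using linear_derivation_proportional[OF der(1) D(1) x D(2)] .
  have one: "deriv_wrt \<iota> t x * D t = 1" using chain[of t] der(2) by simp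
  then show "D t * deriv_wrt \<iota> t x = 1" by (simp add: mult.commute)
  have nz: "deriv_wrt \<iota> t x \<noteq> 0" using one by auto
  have x0: "x \<noteq> 0" using x iota_0 by (metis rangeI)
  have e: "e = fls_subdegree (fls_deriv (\<psi> x))" by (simp add: e_def val_eq der(3))
  show e_nn: "0 \<le> e" if "val_at q x = 0"
    using that fls_deriv_subdegree0 by (simp add: e val_eq)
  let ?d = "fls_deriv (\<psi> g)"
  have val: "val_at q (x * D g) = val_at q x + fls_subdegree ?d - e" if "D g \<noteq> 0"
  proof -
    have "?d = \<psi> (deriv_wrt \<iota> t x) * \<psi> (D g)" using chain[of g] by (simp flip: der(3) hom_mult)
    then have "fls_subdegree ?d = e + fls_subdegree (\<psi> (D g))"
      using that nz by (simp add: e_def val_eq)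
    then show ?thesis using that x0 by (simp add: val_eq hom_mult)
  qed
  have d_nz: "?d \<noteq> 0" if "D g \<noteq> 0"
    using chain[of g] that nz der(3)[of g] by (metis hom_eq_0_iff mult_eq_0_iff)
  have d_ge: "B - 1 \<le> fls_subdegree ?d" if "D g \<noteq> 0"
    using B d_nz[OF that] by (intro fls_subdegree_geI) (auto simp: val_eq)
  have d_ge0: "0 \<le> fls_subdegree ?d" if "D g \<noteq> 0" "B = 0"
  proof (intro fls_subdegree_geI d_nz that)
    fix k :: int assume "k < 0"
    then show "?d $$ k = 0" using B that by (cases "k = - 1") (auto simp: val_eq)
  qed
  show "B \<le> val_at q (x * D g)" if "val_at q x \<noteq> 0"
  proof (cases "D g = 0")
    case False
    have "e = val_at q x - 1" using fls_subdegree_deriv[of "\<psi> x"] that by (simp add: e val_eq)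
    then show ?thesis using val[OF False] d_ge[OF False] by simp
  qed (use B in \<open>simp add: val_eq\<close>)
  show "B - (e + 1) \<le> val_at q (x * D g)" if "val_at q x = 0"
  proof (cases "D g = 0")
    case False
    then show ?thesis using val[OF False] d_ge[OF False] that by simp
  qed (use B e_nn[OF that] in \<open>simp add: val_eq\<close>)
  show "0 \<le> val_at q (x * D g)" if "val_at q x = 0" "e = 0" "B = 0"
  proof (cases "D g = 0")
    case False
    then show ?thesis using val[OF False] d_ge0[OF False that(3)] that by simp
  qed (simp add: val_eq)
qed

end

theorem theorem2p1:
  fixes \<iota> :: "complex \<Rightarrow> 'k::field"
    and C :: "'k set set"
    and p :: "'k set"
    and x f :: 'k
    and xs :: "'k set \<Rightarrow> 'k"
    and \<alpha> :: "nat \<Rightarrow> complex"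
    and a :: "nat \<Rightarrow> int"
    and S1 S2 :: "'k set set"
    and n :: nat
  assumes "smooth_complete_curve \<iota> C"
    and "p \<in> C"
    and "local_parameter p x"
    and "\<And>q. q \<in> C \<Longrightarrow> local_parameter q (xs q)"
    and "f \<notin> polys_in \<iota> x"
    and "f \<noteq> 0" and "val_at p f = 0"
    and "\<And>n. \<alpha> n \<noteq> 0"
    and "strict_mono a" and "a 0 = 0"
    and "sums_at p (\<lambda>n. \<iota> (\<alpha> n) * x powi a n) f"
    and "S1 = {q\<in>C. val_at q f < 0 \<and> val_at q (deriv_wrt \<iota> (xs q) x) = 0}"
    and "S2 = {q\<in>C. val_at q x = 0 \<and> val_at q (deriv_wrt \<iota> (xs q) x) > 0}"
    and "n > 0"
  shows "a n \<le> height C f +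
    (int n - 1) * (int (card S1) + (\<Sum>q\<in>S2. val_at q (deriv_wrt \<iota> (xs q) x) + 1))"
proof -
  interpret smooth_curve \<iota> C using assms(1) by unfold_locales
  obtain \<phi> where p: "expansion \<iota> p x \<phi>" using point_expansion[OF assms(2,3)] .
  interpret p: expansion \<iota> p x \<phi> by (rule p)
  note x_nonconst = p.param_nonconstant
  define D where "D = deriv_wrt \<iota> x"
  have D: "linear_derivation \<iota> D" "D x = 1" "\<And>g. \<phi> (D g) = fls_deriv (\<phi> g)"
    using expansion_derivation[OF p] by (simp_all add: D_def)
  define e where "e = (\<lambda>q. val_at q (deriv_wrt \<iota> (xs q) x))"
  have e_eq: "val_at q (deriv_wrt \<iota> (xs q) x) = e q" for q by (simp add: e_def)
  have S1: "S1 = {q\<in>C. val_at q f < 0 \<and> e q = 0}" and S2: "S2 = {q\<in>C. val_at q x = 0 \<and> e q > 0}"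
    using assms(12,13) by (simp_all add: e_def)
  \<comment> \<open>\<open>G i\<close> results from \<open>f - \<alpha> 0\<close> by applying \<open>\<theta> - a 1\<close> up to \<open>\<theta> - a i\<close>.\<close>
  define G where "G = rec_nat (f - \<iota> (\<alpha> 0)) (\<lambda>i g. x * D g - \<iota> (of_int (a (Suc i))) * g)"
  have G: "G 0 = f - \<iota> (\<alpha> 0)" "G (Suc i) = x * D (G i) - \<iota> (of_int (a (Suc i))) * G i" for i
    by (simp_all add: G_def)
  have G_nth: "\<phi> (G i) $$ m = (\<Prod>j=1..i. of_int (m - a j)) * \<phi> (f - \<iota> (\<alpha> 0)) $$ m" for i m
  proof (induction i)
    case (Suc i)
    have "\<phi> (G (Suc i)) $$ m = of_int (m - a (Suc i)) * \<phi> (G i) $$ m"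
      by (simp add: G p.hom_diff p.hom_mult p.hom_iota p.hom_param D(3) fls_X_times_conv_shift
          left_diff_distrib)
    then show ?case by (simp add: Suc)
  qed (simp add: G)
  note f_nth = p.nth_of_sums[OF assms(11,9,10)]
  define F where "F = G (n - 1)"
  \<comment> \<open>The factors \<open>m - a j\<close> cancel the terms of exponents \<open>a 1\<close> to \<open>a (n - 1)\<close>, and the one of exponent
    \<open>0\<close> was subtracted.\<close>
  have val_F: "val_at p F = a n"
    unfolding p.val_eq
  proof (rule fls_subdegree_eqI)
    have less: "a j < a n" if "j < n" for j using that strict_mono_less[OF assms(9)] by simp
    then have "a n \<noteq> 0" using less[of 0] assms(10,14) by simp
    then have "\<phi> (f - \<iota> (\<alpha> 0)) $$ a n \<noteq> 0"
      using assms(8)[of n] by (simp add: p.hom_diff p.hom_iota f_nth(1))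
    moreover have "(\<Prod>j=1..n - 1. of_int (a n - a j) :: complex) \<noteq> 0"
    proof (subst prod_zero_iff, simp, intro notI, elim bexE)
      fix j assume "j \<in> {1..n - 1}" "(of_int (a n - a j) :: complex) = 0"
      moreover from this have "j < n" using assms(14) by auto
      ultimately show False using less[of j] by (simp flip: of_int_diff)
    qed
    ultimately show "\<phi> F $$ a n \<noteq> 0" unfolding F_def G_nth by simp
    fix m assume m: "m < a n"
    show "\<phi> F $$ m = 0"
    proof (cases "m \<in> range a")
      case True
      then obtain k where k: "m = a k" by blast
      then have "k < n" using m strict_mono_less[OF assms(9)] by simp
      show ?thesis
      proof (cases "k = 0")
        case True
        then show ?thesis unfolding F_def G_nth k
          using f_nth(1)[of 0] assms(10) by (simp add: p.hom_diff p.hom_iota)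
      next
        case False
        then have "k \<in> {1..n - 1}" using \<open>k < n\<close> by simp
        then have "(\<Prod>j=1..n - 1. of_int (m - a j) :: complex) = 0"
          using k by (intro prod_zero) auto
        then show ?thesis unfolding F_def G_nth by simp
      qed
    next
      case False
      moreover have "m \<noteq> 0" using False assms(10) by (metis rangeI)
      ultimately show ?thesis unfolding F_def G_nth by (simp add: p.hom_diff p.hom_iota f_nth(2))
    qed
  qed
  \<comment> \<open>What one application of \<open>\<theta>\<close> may add to the pole order at \<open>q\<close>. The sets \<open>S1\<close> and \<open>S2\<close> are disjoint.\<close>
  define d where "d = (\<lambda>q. (if q \<in> S1 then 1 else 0) + (if q \<in> S2 then e q + 1 else 0))"
  have d_nn: "0 \<le> d q" for q by (auto simp: d_def S2)
  have G_val: "min (val_at q f) 0 - int i * d q \<le> val_at q (G i)" if q: "q \<in> C" for q i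
  proof -
    obtain \<psi> where \<psi>: "expansion \<iota> q (xs q) \<psi>" using point_expansion[OF q assms(4)[OF q]] .
    interpret q: expansion \<iota> q "xs q" \<psi> by (rule \<psi>)
    show ?thesis
    proof (induction i)
      case 0
      then show ?case
        by (simp add: G q.val_eq q.hom_diff q.hom_iota) (intro fls_subdegree_diff_ge; simp)
    next
      case (Suc i)
      define B where "B = min (val_at q f) 0 - int i * d q"
      have "0 \<le> int i * d q" using d_nn by simp
      then have B: "B \<le> 0" "B \<le> val_at q (G i)" using Suc by (auto simp: B_def)
      note bound = euler_pole_bound[OF \<psi> D(1,2) x_nonconst B, unfolded e_eq]
      have "B - d q \<le> val_at q (x * D (G i))"
      proof (cases "val_at q x = 0")
        case False
        then show ?thesis using bound(1) d_nn[of q] by linarith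
      next
        case True
        consider "e q > 0" | "e q = 0" "val_at q f < 0" | "e q = 0" "val_at q f \<ge> 0"
          using bound(4)[OF True] by linarith
        then show ?thesis
        proof cases
          case 1
          then have "d q = e q + 1" using True q by (simp add: d_def S1 S2)
          then show ?thesis using bound(2)[OF True] by simp
        next
          case 2
          then have "d q = e q + 1" using True q by (simp add: d_def S1 S2)
          then show ?thesis using bound(2)[OF True] by simp
        next
          case 3
          then have "d q = 0" by (simp add: d_def S1 S2)
          moreover from this 3 have "B = 0" by (simp add: B_def)
          ultimately show ?thesis using bound(3)[OF True 3(1)] by simp
        qed
      qed
      moreover have "B - d q \<le> fls_subdegree (fls_const (of_int (a (Suc i))) * \<psi> (G i))"
        using B d_nn[of q] by (intro fls_subdegree_const_mult_ge) (auto simp: q.val_eq)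
      ultimately have "B - d q \<le> val_at q (G (Suc i))"
        using B d_nn[of q] by (simp add: G q.val_eq q.hom_diff q.hom_mult q.hom_iota fls_subdegree_diff_ge)
      then show ?case by (simp add: B_def algebra_simps)
    qed
  qed
  define T where "T = {q\<in>C. val_at q f < 0} \<union> S2"
  have fin_poles: "finite {q\<in>C. val_at q f < 0}"
    using finite_poles[of f] by (rule rev_finite_subset) (auto simp: point_mem_iff)
  \<comment> \<open>Where \<open>dx\<close> vanishes, \<open>d/dx\<close> of a local parameter has a pole.\<close>
  have "S2 \<subseteq> {q\<in>C. \<exists>g\<in>q. D g \<notin> q}"
  proof
    fix q assume "q \<in> S2"
    then have q: "q \<in> C" "e q > 0" by (auto simp: S2)
    obtain \<psi> where \<psi>: "expansion \<iota> q (xs q) \<psi>" using point_expansion[OF q(1) assms(4)[OF q(1)]] .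
    interpret q: expansion \<iota> q "xs q" \<psi> by (rule \<psi>)
    have one: "D (xs q) * deriv_wrt \<iota> (xs q) x = 1"
      using euler_pole_bound(5)[OF \<psi> D(1,2) x_nonconst, of 0 0] by (simp add: q.val_eq)
    then have "D (xs q) \<noteq> 0" "deriv_wrt \<iota> (xs q) x \<noteq> 0" by auto
    then have "fls_subdegree (\<psi> (D (xs q))) + e q = fls_subdegree (\<psi> 1)"
      unfolding e_def q.val_eq one[symmetric] by (simp add: q.hom_mult)
    then have "D (xs q) \<notin> q" using q(2) by (simp add: q.mem_iff)
    moreover have "xs q \<in> q" by (simp add: q.mem_iff q.hom_param)
    ultimately show "q \<in> {q\<in>C. \<exists>g\<in>q. D g \<notin> q}" using q(1) by blast
  qed
  then have fin_S2: "finite S2" using finite_derivation_poles[OF D(1)] by (rule finite_subset)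
  have "S1 \<subseteq> {q\<in>C. val_at q f < 0}" by (auto simp: S1)
  then have fin_S1: "finite S1" using fin_poles by (rule finite_subset)
  have fin_T: "finite T" using fin_poles fin_S2 by (simp add: T_def)
  have sub_T: "S1 \<subseteq> T" "S2 \<subseteq> T" by (auto simp: T_def S1)
  let ?b = "\<lambda>q. - min (val_at q f) 0 + (int n - 1) * d q"
  have b_ge: "- val_at q F \<le> ?b q" if "q \<in> C" for q
    using G_val[OF that, of "n - 1"] assms(14) by (simp add: F_def of_nat_diff)
  have b_nn: "0 \<le> ?b q" for q
  proof -
    have "0 \<le> (int n - 1) * d q" using d_nn[of q] assms(14) by (intro mult_nonneg_nonneg) auto
    then show ?thesis by linarith
  qed
  have "a n > 0" using strict_mono_less[OF assms(9), of 0 n] assms(10,14) by simp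
  then have "a n \<le> (\<Sum>q\<in>{q\<in>C. val_at q F < 0}. - val_at q F)"
    using order_le_poles[OF p, of F] val_F by simp
  also have "\<dots> \<le> (\<Sum>q\<in>{q\<in>C. val_at q F < 0}. ?b q)"
    by (intro sum_mono b_ge) simp
  also have "\<dots> \<le> (\<Sum>q\<in>T. ?b q)"
  proof (intro sum_mono2 fin_T b_nn subsetI)
    fix q assume "q \<in> {q\<in>C. val_at q F < 0}"
    then have "q \<in> C" "?b q \<noteq> 0" using b_ge[of q] by auto
    then show "q \<in> T" by (auto simp: T_def d_def S1 split: if_splits)
  qed
  also have "\<dots> = - (\<Sum>q\<in>T. min (val_at q f) 0) + (int n - 1) * (\<Sum>q\<in>T. d q)"
    by (simp add: sum_subtractf sum_distrib_left)
  also have "(\<Sum>q\<in>T. min (val_at q f) 0) = - height C f"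
    unfolding height_def minus_minus
    by (rule sum.mono_neutral_right[OF fin_T]) (auto simp: T_def S2)
  also have "(\<Sum>q\<in>T. d q) = int (card S1) + (\<Sum>q\<in>S2. e q + 1)"
  proof -
    have "(\<Sum>q\<in>T. d q) = (\<Sum>q\<in>T. if q \<in> S1 then 1 else 0) + (\<Sum>q\<in>T. if q \<in> S2 then e q + 1 else 0)"
      by (simp add: d_def sum.distrib)
    also have "(\<Sum>q\<in>T. if q \<in> S1 then 1 else 0 :: int) = int (card S1)"
      using fin_T sub_T by (simp add: sum.If_cases Int_absorb1 flip: Int_def)
    also have "(\<Sum>q\<in>T. if q \<in> S2 then e q + 1 else 0) = (\<Sum>q\<in>S2. e q + 1)"
      using fin_T sub_T by (simp add: sum.If_cases Int_absorb1)
    finally show ?thesis .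
  qed
  finally show ?thesis by (simp add: e_def)
qed

end
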